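(* Let $\vec{x}^{(1)},\vec{x}^{(2)},\vec{x}^{(3)}\in\mathbb{R}^2$ satisfy, for each $i=1,2,3$, $\left|\sum_{j\neq i}\frac{\vec{x}^{(j)}-\vec{x}^{(i)}}{|\vec{x}^{(j)}-\vec{x}^{(i)}|}\right|>1$, and let $\vec{a}_\infty$ be the unique equilibrium point of $\vec{x}^{(1)},\vec{x}^{(2)},\vec{x}^{(3)}$. There is a small constant $\varepsilon>0$ such that, for initial data $\vec{\alpha}_0\in\mathbb{R}^3$, $\vec{a}_0\in\mathbb{R}^2$, with $\vec{\alpha}_\infty:=\frac{\alpha_0^{(1)}+\alpha_0^{(2)}+\alpha_0^{(3)}}{3}(1,1,1)$, if $$|\vec{\alpha}_0-\vec{\alpha}_\infty|+|\vec{a}_0-\vec{a}_\infty|<\varepsilon,$$ then the associated solution $(\vec{\alpha},\vec{a})$ of the grain boundary system with $\vec{\alpha}(0)=\vec{\alpha}_0$, $\vec{a}(0)=\vec{a}_0$ is global in time and satisfies $$|\vec{\alpha}(t)-\vec{\alpha}_\infty|+|\vec{a}(t)-\vec{a}_\infty|\le C e^{-\lambda^\star t}\qquad\text{for all } t\ge0,$$ for some positive constants $C,\lambda^\star>0$, where the decay order satisfies $\lambda^\star\ge\lambda:=\min\{\gamma\,\sigma_{\theta\theta}(0)\,\lambda_1,\ \eta\,\sigma(0)\,\lambda_2\}$.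
   Context: Constants $\gamma,\eta>0$ are fixed. The function $\sigma:\mathbb{R}\to\mathbb{R}$ is $C^3$ and satisfies: $\sigma(\theta)\ge\sigma(0)>0$ for all $\theta\in\mathbb{R}$; $\sigma_\theta(\theta)\theta\ge0$ for all $\theta\in\mathbb{R}$ and $\sigma_{\theta\theta}(0)>0$; and $\sigma_\theta(\theta)=0$ if and only if $\theta=0$ (subscripts denote derivatives). Indices are cyclic mod 3: $\alpha^{(0)}=\alpha^{(3)}$, $\alpha^{(4)}=\alpha^{(1)}$, $\vec{b}^{(4)}=\vec{b}^{(1)}$; and $\Delta^{(j)}\alpha:=\alpha^{(j-1)}-\alpha^{(j)}$ (so $\Delta^{(4)}\alpha=\Delta^{(1)}\alpha$). $|\cdot|$ is the Euclidean norm. Grain boundary system, for unknowns $\vec{\alpha}(t)=(\alpha^{(1)},\alpha^{(2)},\alpha^{(3)})(t)\in\mathbb{R}^3$, $\vec{a}(t)\in\mathbb{R}^2$, with $\vec{b}^{(j)}(t):=\vec{x}^{(j)}-\vec{a}(t)$: $$\frac{d\alpha^{(j)}}{dt}=-\gamma\Bigl(\sigma_\theta(\Delta^{(j+1)}\alpha)|\vec{b}^{(j+1)}|-\sigma_\theta(\Delta^{(j)}\alpha)|\vec{b}^{(j)}|\Bigr),\ j=1,2,3,\qquad \frac{d\vec{a}}{dt}=\eta\sum_{j=1}^3\sigma(\Delta^{(j)}\alpha)\frac{\vec{b}^{(j)}}{|\vec{b}^{(j)}|}.$$ A solution on a time interval is a $C^1$ pair $(\vec{\alpha},\vec{a})$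 satisfying these equations there, with $\vec{a}(t)\ne\vec{x}^{(j)}$ for all $t$ and $j$. The equilibrium point $\vec{a}_\infty\in\mathbb{R}^2$ is the point, distinct from all $\vec{x}^{(j)}$, with $\sum_{j=1}^3\vec{b}_\infty^{(j)}/|\vec{b}_\infty^{(j)}|=\vec{0}$, where $\vec{b}_\infty^{(j)}:=\vec{x}^{(j)}-\vec{a}_\infty$; under the stated condition on the $\vec{x}^{(j)}$ it exists and is unique (Fermat–Torricelli point). With $\beta_j:=|\vec{b}_\infty^{(j)}|$, $\lambda_1:=\beta_1+\beta_2+\beta_3-\sqrt{\tfrac12\bigl((\beta_1-\beta_2)^2+(\beta_2-\beta_3)^2+(\beta_3-\beta_1)^2\bigr)}>0$. The number $\lambda_2>0$ is the smallest eigenvalue of the symmetric $2\times2$ matrix $L_{\vec a}:=\sum_{j=1}^3\frac{1}{|\vec{b}_\infty^{(j)}|}\Bigl(I-\frac{\vec{b}_\infty^{(j)}}{|\vec{b}_\infty^{(j)}|}\otimes\frac{\vec{b}_\infty^{(j)}}{|\vec{b}_\infty^{(j)}|}\Bigr)$, where $\otimes$ is the outer product. *)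

theory Defs
  imports "HOL-Analysis.Analysis"
begin

text \<open>
  Indices live in the numeral type \<open>3\<close>, whose arithmetic is modulo 3 (so \<open>3 = 0\<close>,
  \<open>4 = 1\<close>); the cyclic index conventions therefore hold by construction.  The vertices
  form a vector \<open>x :: real^2^3\<close>, with \<open>x $ j\<close> the \<open>j\<close>-th point of the plane.
\<close>

definition C_diff :: "nat \<Rightarrow> (real \<Rightarrow> real) \<Rightarrow> bool"
  where "C_diff n f \<longleftrightarrow> (\<forall>k<n. ((deriv ^^ k) f) C1_differentiable_on UNIV)"

definition \<Delta> :: "3 \<Rightarrow> real^3 \<Rightarrow> real"
  where "\<Delta> j \<alpha> = \<alpha> $ (j - 1) - \<alpha> $ j"

definition bvec :: "real^2^3 \<Rightarrow> real^2 \<Rightarrow> 3 \<Rightarrow> real^2"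
  where "bvec x a j = x $ j - a"

text \<open>A vertex coinciding with \<open>x $ i\<close> contributes the zero vector to the sum below, as
  division by 0 yields 0.  The sum then has norm at most 1, so the condition forces the three
  points to be pairwise distinct.\<close>

definition vertex_condition :: "real^2^3 \<Rightarrow> bool"
  where "vertex_condition x \<longleftrightarrow>
    (\<forall>i. norm (\<Sum>j\<in>UNIV - {i}. (x $ j - x $ i) /\<^sub>R norm (x $ j - x $ i)) > 1)"

definition equilibrium_point :: "real^2^3 \<Rightarrow> real^2 \<Rightarrow> bool"
  where "equilibrium_point x a \<longleftrightarrow>
    (\<forall>j. a \<noteq> x $ j) \<and> (\<Sum>j\<in>UNIV. bvec x a j /\<^sub>R norm (bvec x a j)) = 0"

text \<open>The derivatives are one-sided at endpoints of \<open>J\<close> that belong to \<open>J\<close>.\<close>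

definition grain_boundary_solution ::
  "real \<Rightarrow> real \<Rightarrow> (real \<Rightarrow> real) \<Rightarrow> real^2^3 \<Rightarrow> real set \<Rightarrow> (real \<Rightarrow> real^3) \<Rightarrow> (real \<Rightarrow> real^2) \<Rightarrow> bool"
  where "grain_boundary_solution \<gamma> \<eta> \<sigma> x J \<alpha> a \<longleftrightarrow>
    (\<forall>t\<in>J. \<forall>j. a t \<noteq> x $ j) \<and>
    (\<exists>\<alpha>' a'. continuous_on J \<alpha>' \<and> continuous_on J a' \<and>
      (\<forall>t\<in>J.
        (\<alpha> has_vector_derivative \<alpha>' t) (at t within J) \<and>
        (a has_vector_derivative a' t) (at t within J) \<and>
        (\<forall>j. \<alpha>' t $ j =
          - \<gamma> * (deriv \<sigma> (\<Delta> (j + 1) (\<alpha> t)) * norm (bvec x (a t) (j + 1))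
                 - deriv \<sigma> (\<Delta> j (\<alpha> t)) * norm (bvec x (a t) j))) \<and>
        a' t = \<eta> *\<^sub>R (\<Sum>j\<in>UNIV. \<sigma> (\<Delta> j (\<alpha> t)) *\<^sub>R (bvec x (a t) j /\<^sub>R norm (bvec x (a t) j)))))"

definition lambda1 :: "real^2^3 \<Rightarrow> real^2 \<Rightarrow> real"
  where "lambda1 x a =
    (let \<beta> = (\<lambda>j. norm (bvec x a j))
     in \<beta> 1 + \<beta> 2 + \<beta> 3
        - sqrt (1/2 * ((\<beta> 1 - \<beta> 2)\<^sup>2 + (\<beta> 2 - \<beta> 3)\<^sup>2 + (\<beta> 3 - \<beta> 1)\<^sup>2)))"

definition outer_product :: "real^'n \<Rightarrow> real^'m \<Rightarrow> real^'m^'n"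
  where "outer_product u v = (\<chi> i k. u $ i * v $ k)"

definition L_mat :: "real^2^3 \<Rightarrow> real^2 \<Rightarrow> real^2^2"
  where "L_mat x a =
    (\<Sum>j\<in>UNIV. (1 / norm (bvec x a j)) *\<^sub>R
      (mat 1 - outer_product (bvec x a j /\<^sub>R norm (bvec x a j)) (bvec x a j /\<^sub>R norm (bvec x a j))))"

text \<open>Used for symmetric matrices only, whose set of real eigenvalues is finite and nonempty.\<close>

definition smallest_eigenvalue :: "real^'n^'n \<Rightarrow> real"
  where "smallest_eigenvalue A = Min {\<mu>. \<exists>v. v \<noteq> 0 \<and> A *v v = \<mu> *\<^sub>R v}"

definition lambda2 :: "real^2^3 \<Rightarrow> real^2 \<Rightarrow> real"
  where "lambda2 x a = smallest_eigenvalue (L_mat x a)"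

definition mean_vec :: "real^3 \<Rightarrow> real^3"
  where "mean_vec \<alpha> = (\<chi> i. (\<alpha> $ 1 + \<alpha> $ 2 + \<alpha> $ 3) / 3)"

end

theory Submission
  imports Defs
begin

text \<open>
  Let \<open>u = \<alpha> - mean\<close> and \<open>v = a - a_inf\<close>.  The mean of \<open>\<alpha>\<close> is conserved, the linearization at the
  equilibrium decouples into two symmetric operators with spectral gaps \<open>\<gamma> \<sigma>''(0) \<lambda>\<^sub>1\<close> and
  \<open>\<eta> \<sigma>(0) \<lambda>\<^sub>2\<close>, and the remainder is quadratic.  Hence \<open>E = \<bar>u\<bar>\<^sup>2 + \<bar>v\<bar>\<^sup>2\<close> satisfies
  \<open>E' \<le> - 2 \<lambda> E + 2 K E powr (3/2)\<close> near the equilibrium.  This keeps solutions in a small ball,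
  where the field is Lipschitz, and yields decay of \<open>sqrt E\<close> at rate \<open>\<lambda>\<close> itself.
\<close>

section \<open>Ordinary differential equations\<close>

text \<open>Every point \<open>(vec m, a_inf)\<close> is an equilibrium, so the linearization has a
  neutral direction and decay can only hold transversally to this line. Conservation of the mean
  selects the limit point from the data and confines the motion to a hyperplane on which both
  spectral gaps apply. The field sees \<alpha> only through differences, so the radius and the error
  constant are the same for every \<open>m\<close>; this makes one \<epsilon> serve all initial
  data. The decoupling rests on \<open>deriv \<sigma> 0 = 0\<close>: a displacement of
  \<open>a\<close> changes an edge length that is multiplied by a factor vanishing at \<theta> = 0,
  and a change of \<alpha> alters \<open>\<sigma> (\<Delta> j \<alpha>)\<close> only to second
  order. All cross terms in the energy are therefore cubic. The field is singular at the vertices.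
  Existence avoids continuing local solutions: a globally Lipschitz field that agrees with the given
  one on a ball is solved for all times at once. Uniqueness is a separate matter, since a competing
  solution is not known beforehand to stay in the ball.\<close>

lemma integral_has_vector_derivative_atLeast:
  fixes f :: "real \<Rightarrow> 'a::banach"
  assumes "continuous_on {0..} f" "0 \<le> t"
  shows "((\<lambda>u. integral {0..u} f) has_vector_derivative f t) (at t within {0..})"
proof -
  have "((\<lambda>u. integral {0..u} f) has_vector_derivative f t) (at t within {0..t+1})"
    using assms by (intro integral_has_vector_derivative) (auto intro: continuous_on_subset)
  moreover have "at t within {0..t+1} = at t within {0..}"
    by (rule at_within_nhd[where S = "{..<t+1}"]) auto
  ultimately show ?thesis by simp
qed

text \<open>Integrating a function of growth \<open>exp (K * s)\<close> gains the factor
  \<open>1 / K\<close>. With \<open>K\<close> larger than the Lipschitz constant, this gain is what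
  makes Picard's operator contract without any restriction on the length of the time
  interval.\<close>

lemma norm_weighted_integral_le:
  fixes f :: "real \<Rightarrow> 'a::euclidean_space"
  assumes "continuous_on {0..} f" and "K > 0" and "0 \<le> t" and "B \<ge> 0"
    and "\<And>s. 0 \<le> s \<Longrightarrow> norm (f s) \<le> B * exp (K * s)"
  shows "norm (exp (- K * t) *\<^sub>R integral {0..t} f) \<le> B / K"
proof -
  have int: "((\<lambda>s. B * exp (K * s)) has_integral B / K * exp (K * t) - B / K * exp (K * 0)) {0..t}"
    using assms(2,3)
    by (intro fundamental_theorem_of_calculus)
       (auto intro!: derivative_eq_intros simp flip: has_real_derivative_iff_has_vector_derivative)
  have "norm (integral {0..t} f) \<le> integral {0..t} (\<lambda>s. B * exp (K * s))"
    using assms int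
    by (intro integral_norm_bound_integral integrable_continuous_real)
       (auto intro: continuous_on_subset has_integral_integrable intro!: continuous_intros)
  also have "\<dots> = B / K * exp (K * t) - B / K"
    unfolding integral_unique[OF int] by simp
  also have "\<dots> \<le> B / K * exp (K * t)"
    using assms by simp
  finally have "norm (integral {0..t} f) \<le> B / K * exp (K * t)" .
  then have "exp (- K * t) * norm (integral {0..t} f) \<le> exp (- K * t) * (B / K * exp (K * t))"
    by (intro mult_left_mono) auto
  also have "\<dots> = B / K"
    by (simp add: exp_minus field_simps)
  finally show ?thesis by simp
qed

text \<open>Picard's operator is a contraction on all of \<open>[0, \<infinity>)\<close> at once in the weighted norm
  \<open>sup\<^sub>t exp (- 2 L t) |z t - z0|\<close>.\<close>

lemma ode_exists_global:
  fixes G :: "'a::euclidean_space \<Rightarrow> 'a"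
  assumes lip: "\<And>y z. norm (G y - G z) \<le> L * norm (y - z)" and "L > 0"
  obtains z where "z 0 = z0"
    and "\<And>t. 0 \<le> t \<Longrightarrow> (z has_vector_derivative G (z t)) (at t within {0..})"
proof -
  \<comment> \<open>The contraction factor will be \<open>L / K\<close>, here 1/2.\<close>
  define K where "K = 2 * L"
  have "K > 0" using assms by (simp add: K_def)
  have contG: "continuous_on A G" for A
  proof (rule continuous_on_subset)
    have "L-lipschitz_on UNIV G"
      using assms by (intro lipschitz_onI) (auto simp: dist_norm)
    then show "continuous_on UNIV G" by (rule lipschitz_on_continuous_on)
  qed simp
  \<comment> \<open>The unknown is the weighted deviation
    \<open>w t = exp (- K * t) *\<^sub>R (z t - z0)\<close>, sought among bounded continuous
    functions, which are complete in the sup metric.\<close>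
  define h where "h w s = G (z0 + exp (K * s) *\<^sub>R apply_bcontfun w s)" for w :: "real \<Rightarrow>\<^sub>C 'a" and s
  have h_cont: "continuous_on A (h w)" for w A
    unfolding h_def using continuous_on_apply_bcontfun
    by (intro continuous_on_compose2[OF contG[of UNIV]] continuous_intros) auto
  \<comment> \<open>Bounded continuous functions live on the whole line; \<open>max 0 t\<close>
    extends the operator by its value 0 at time 0 to negative times.\<close>
  define I where "I w t = exp (- K * max 0 t) *\<^sub>R integral {0..max 0 t} (h w)" for w t
  have I_cont: "continuous_on UNIV (I w)" for w
  proof -
    have "continuous_on {0..} (\<lambda>u. integral {0..u} (h w))"
      using integral_has_vector_derivative_atLeast[OF h_cont]
      by (auto simp: continuous_on_eq_continuous_within intro: has_vector_derivative_continuous)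
    then have "continuous_on UNIV (\<lambda>t. integral {0..max 0 t} (h w))"
      by (rule continuous_on_compose2) (auto intro!: continuous_intros)
    then show ?thesis unfolding I_def by (intro continuous_intros)
  qed
  have h_bound: "norm (h w s) \<le> (norm (G z0) + L * norm w) * exp (K * s)" if "0 \<le> s" for w s
  proof -
    have "norm (h w s) \<le> norm (G z0) + norm (h w s - G z0)"
      by (metis norm_triangle_sub)
    also have "norm (h w s - G z0) \<le> L * norm (exp (K * s) *\<^sub>R apply_bcontfun w s)"
      unfolding h_def using lip[of "z0 + exp (K * s) *\<^sub>R apply_bcontfun w s" z0] by simp
    also have "\<dots> \<le> L * (exp (K * s) * norm w)"
      using \<open>L > 0\<close> norm_bounded[of w s] by simp
    also have "norm (G z0) \<le> norm (G z0) * exp (K * s)"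
      using that \<open>K > 0\<close> by (simp add: mult_le_cancel_left1)
    finally show ?thesis by (simp add: algebra_simps)
  qed
  have I_bound: "norm (I w t) \<le> (norm (G z0) + L * norm w) / K" for w t
    unfolding I_def using \<open>K > 0\<close> \<open>L > 0\<close>
    by (intro norm_weighted_integral_le h_cont h_bound) auto
  define T where "T w = Bcontfun (I w)" for w
  have T_apply: "apply_bcontfun (T w) = I w" for w
    unfolding T_def
    by (rule Bcontfun_inverse, rule bcontfun_normI, rule I_cont, rule I_bound)
  have contr: "dist (T w) (T v) \<le> 1/2 * dist w v" for w v
  proof (rule dist_bound)
    fix t :: real
    define \<tau> where "\<tau> = max 0 t"
    have "I w t - I v t = exp (- K * \<tau>) *\<^sub>R integral {0..\<tau>} (\<lambda>s. h w s - h v s)"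
      unfolding I_def \<tau>_def
      by (subst integral_diff)
         (auto intro!: integrable_continuous_real h_cont simp: algebra_simps)
    moreover have "norm (exp (- K * \<tau>) *\<^sub>R integral {0..\<tau>} (\<lambda>s. h w s - h v s)) \<le> (L * dist w v) / K"
    proof (rule norm_weighted_integral_le)
      fix s :: real assume "0 \<le> s"
      have "norm (h w s - h v s) \<le> L * norm (exp (K * s) *\<^sub>R (apply_bcontfun w s - apply_bcontfun v s))"
        unfolding h_def
        using lip[of "z0 + exp (K * s) *\<^sub>R apply_bcontfun w s" "z0 + exp (K * s) *\<^sub>R apply_bcontfun v s"]
        by (simp add: algebra_simps)
      also have "\<dots> \<le> L * (exp (K * s) * dist w v)"
        using \<open>L > 0\<close> dist_bounded[of w s v] by (simp add: dist_norm)
      finally show "norm (h w s - h v s) \<le> L * dist w v * exp (K * s)"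
        by (simp add: algebra_simps)
    qed (use \<open>K > 0\<close> \<open>L > 0\<close> in \<open>auto simp: \<tau>_def intro!: continuous_intros h_cont\<close>)
    ultimately show "dist (apply_bcontfun (T w) t) (apply_bcontfun (T v) t) \<le> 1/2 * dist w v"
      using \<open>L > 0\<close> by (simp add: T_apply dist_norm K_def)
  qed
  then obtain w where w: "T w = w"
    using banach_fix_type[of "1/2" T] by auto
  define z where "z t = z0 + exp (K * t) *\<^sub>R apply_bcontfun w t" for t
  have z_eq: "z t = z0 + integral {0..t} (h w)" if "t \<ge> 0" for t
    using that fun_cong[OF T_apply, of w t]
    by (simp add: w z_def I_def exp_minus)
  show thesis
  proof
    show "z 0 = z0" by (simp add: z_eq)
    fix t :: real assume t: "0 \<le> t"
    have "((\<lambda>t. z0 + integral {0..t} (h w)) has_vector_derivative (0 + h w t)) (at t within {0..})"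
      by (intro has_vector_derivative_add has_vector_derivative_const
            integral_has_vector_derivative_atLeast h_cont t)
    then have "((\<lambda>t. z0 + integral {0..t} (h w)) has_vector_derivative G (z t)) (at t within {0..})"
      by (simp add: h_def z_def)
    then show "(z has_vector_derivative G (z t)) (at t within {0..})"
      by (rule has_vector_derivative_transform[rotated 2]) (use t z_eq in auto)
  qed
qed

section \<open>Gronwall's inequality and uniqueness of trajectories\<close>

text \<open>\<open>E t * exp (- \<phi> t)\<close> has nonpositive derivative. The rate enters
  through a primitive \<phi>, so that time-dependent rates give explicit bounds; derivatives are
  needed only inside the interval, which spares the one-sided ones at its ends.\<close>

lemma gronwall_differential:
  fixes E \<phi> :: "real \<Rightarrow> real"
  assumes "0 \<le> T" "continuous_on {0..T} E" "continuous_on {0..T} \<phi>"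
    and "\<And>t. 0 < t \<Longrightarrow> t < T \<Longrightarrow> (E has_real_derivative E' t) (at t)"
    and "\<And>t. 0 < t \<Longrightarrow> t < T \<Longrightarrow> (\<phi> has_real_derivative \<phi>' t) (at t)"
    and "\<And>t. 0 < t \<Longrightarrow> t < T \<Longrightarrow> E' t \<le> \<phi>' t * E t"
  shows "E T \<le> exp (\<phi> T - \<phi> 0) * E 0"
proof -
  have "E T * exp (- \<phi> T) \<le> E 0 * exp (- \<phi> 0)"
  proof (rule DERIV_nonpos_imp_decreasing_open[of 0 T "\<lambda>t. E t * exp (- \<phi> t)"])
    fix t assume t: "0 < t" "t < T"
    have "((\<lambda>t. E t * exp (- \<phi> t)) has_real_derivative (E' t - \<phi>' t * E t) * exp (- \<phi> t)) (at t)"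
      by (rule derivative_eq_intros assms(4,5) t refl)+ (simp add: algebra_simps)
    moreover have "(E' t - \<phi>' t * E t) * exp (- \<phi> t) \<le> 0"
      using assms(6)[OF t] by (simp add: mult_nonpos_nonneg)
    ultimately show "\<exists>y. ((\<lambda>t. E t * exp (- \<phi> t)) has_real_derivative y) (at t) \<and> y \<le> 0"
      by blast
  qed (use assms in \<open>auto intro!: continuous_intros\<close>)
  then have "E T * exp (- \<phi> T) * exp (\<phi> T) \<le> E 0 * exp (- \<phi> 0) * exp (\<phi> T)"
    by (intro mult_right_mono) auto
  then show ?thesis
    by (simp add: exp_minus exp_diff field_simps)
qed

lemma has_real_derivative_norm_power2:
  fixes z :: "real \<Rightarrow> 'a::real_inner"
  assumes "(z has_vector_derivative z') (at t)"
  shows "((\<lambda>t. (norm (z t))\<^sup>2) has_real_derivative 2 * (z t \<bullet> z')) (at t)"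
proof -
  have "(z has_derivative (\<lambda>h. h *\<^sub>R z')) (at t)"
    using assms by (simp add: has_vector_derivative_def)
  from has_derivative_inner[OF this this]
  have "((\<lambda>t. (norm (z t))\<^sup>2) has_derivative (\<lambda>h. z t \<bullet> (h *\<^sub>R z') + (h *\<^sub>R z') \<bullet> z t)) (at t)"
    by (simp only: power2_norm_eq_inner)
  moreover have "(\<lambda>h. z t \<bullet> (h *\<^sub>R z') + (h *\<^sub>R z') \<bullet> z t) = (*) (2 * (z t \<bullet> z'))"
    by (auto simp: inner_commute[of z'])
  ultimately show ?thesis by (simp add: has_field_derivative_def)
qed

text \<open>The squared distance grows at rate at most \<open>2 * L\<close>. The Lipschitz bound is
  required only between the two trajectories at equal times, so it may come from any set that
  contains both.\<close>

lemma ode_unique: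
  fixes y z :: "real \<Rightarrow> 'a::real_inner"
  assumes "0 \<le> T"
    and y: "\<And>t. t \<in> {0..T} \<Longrightarrow> (y has_vector_derivative F (y t)) (at t within {0..T})"
    and z: "\<And>t. t \<in> {0..T} \<Longrightarrow> (z has_vector_derivative F (z t)) (at t within {0..T})"
    and lip: "\<And>t. t \<in> {0..T} \<Longrightarrow> norm (F (y t) - F (z t)) \<le> L * norm (y t - z t)"
    and "y 0 = z 0"
  shows "y T = z T"
proof -
  have deriv: "((\<lambda>t. y t - z t) has_vector_derivative F (y t) - F (z t)) (at t within {0..T})"
    if "t \<in> {0..T}" for t
    using has_vector_derivative_diff[OF y z] that by blast
  have "(norm (y T - z T))\<^sup>2 \<le> exp (2 * L * T - 2 * L * 0) * (norm (y 0 - z 0))\<^sup>2"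
  proof (rule gronwall_differential[where \<phi> = "\<lambda>t. 2 * L * t" and \<phi>' = "\<lambda>_. 2 * L"])
    have "continuous_on {0..T} (\<lambda>t. y t - z t)"
      unfolding continuous_on_eq_continuous_within
      using deriv has_vector_derivative_continuous by blast
    then show "continuous_on {0..T} (\<lambda>t. (norm (y t - z t))\<^sup>2)"
      by (intro continuous_on_power continuous_on_norm)
    fix t assume t: "0 < t" "t < T"
    then have "((\<lambda>t. y t - z t) has_vector_derivative F (y t) - F (z t)) (at t)"
      using deriv[of t] at_within_interior[of t "{0..T}"] by simp
    then show "((\<lambda>t. (norm (y t - z t))\<^sup>2) has_real_derivative
        2 * ((y t - z t) \<bullet> (F (y t) - F (z t)))) (at t)"
      by (rule has_real_derivative_norm_power2)
    have "(y t - z t) \<bullet> (F (y t) - F (z t)) \<le> norm (y t - z t) * norm (F (y t) - F (z t))"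
      by (rule norm_cauchy_schwarz)
    also have "\<dots> \<le> norm (y t - z t) * (L * norm (y t - z t))"
      using lip t by (intro mult_left_mono) auto
    finally show "2 * ((y t - z t) \<bullet> (F (y t) - F (z t))) \<le> 2 * L * (norm (y t - z t))\<^sup>2"
      by (simp add: power2_eq_square algebra_simps)
  qed (auto intro!: derivative_eq_intros continuous_intros \<open>0 \<le> T\<close>)
  then show ?thesis using \<open>y 0 = z 0\<close> by simp
qed

section \<open>Confinement to a ball and exponential decay\<close>

text \<open>By the triangle inequality no point of the ball is closer to \<open>z\<close> than
  \<open>norm (z - c) - \<delta>\<close>, and the radial point attains this value.\<close>

lemma closest_point_cball:
  fixes c :: "'a::euclidean_space"
  assumes "0 < \<delta>" "\<delta> \<le> norm (z - c)"
  shows "closest_point (cball c \<delta>) z = c + (\<delta> / norm (z - c)) *\<^sub>R (z - c)"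
proof (rule closest_point_unique[symmetric])
  let ?p = "c + (\<delta> / norm (z - c)) *\<^sub>R (z - c)"
  show "?p \<in> cball c \<delta>"
    using assms by (auto simp: dist_norm)
  have "z - ?p = (1 - \<delta> / norm (z - c)) *\<^sub>R (z - c)"
    by (simp add: algebra_simps)
  then have "dist z ?p = (1 - \<delta> / norm (z - c)) * norm (z - c)"
    using assms by (simp add: dist_norm divide_le_eq_1)
  also have "\<dots> = norm (z - c) - \<delta>"
    using assms by (auto simp: field_simps)
  finally have p: "dist z ?p = norm (z - c) - \<delta>" .
  show "\<forall>y\<in>cball c \<delta>. dist z ?p \<le> dist z y"
  proof
    fix y assume "y \<in> cball c \<delta>"
    then show "dist z ?p \<le> dist z y"
      using dist_triangle[of z c y] p by (simp add: dist_norm norm_minus_commute)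
  qed
qed auto

text \<open>The field \<open>F\<close> is replaced by \<open>F \<circ> closest_point (cball c \<delta>)\<close>.  The projection is radial, so the
  modified field points inwards outside the ball too and its solution never leaves the ball.\<close>

lemma ode_exists_in_cball:
  fixes F :: "'a::euclidean_space \<Rightarrow> 'a"
  assumes "L > 0" "\<delta> > 0"
    and lip: "\<And>p q. p \<in> cball c \<delta> \<Longrightarrow> q \<in> cball c \<delta> \<Longrightarrow> norm (F p - F q) \<le> L * norm (p - q)"
    and cons: "\<And>p. p \<in> cball c \<delta> \<Longrightarrow> w \<bullet> F p = 0"
    and inward: "\<And>p. p \<in> cball c \<delta> \<Longrightarrow> w \<bullet> (p - c) = 0 \<Longrightarrow> (p - c) \<bullet> F p \<le> 0"
    and z0: "z0 \<in> cball c \<delta>" "w \<bullet> (z0 - c) = 0"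
  obtains z where "z 0 = z0"
    and "\<And>t. 0 \<le> t \<Longrightarrow> (z has_vector_derivative F (z t)) (at t within {0..})"
    and "\<And>t. 0 \<le> t \<Longrightarrow> z t \<in> cball c \<delta>"
    and "\<And>t. 0 \<le> t \<Longrightarrow> w \<bullet> (z t - c) = 0"
proof -
  define P where "P = closest_point (cball c \<delta>)"
  have P_in: "P z \<in> cball c \<delta>" for z
    unfolding P_def using \<open>\<delta> > 0\<close> by (intro closest_point_in_set) auto
  have "norm (F (P y) - F (P z)) \<le> L * norm (y - z)" for y z
  proof -
    have "norm (F (P y) - F (P z)) \<le> L * norm (P y - P z)"
      by (intro lip P_in)
    also have "norm (P y - P z) \<le> norm (y - z)"
      unfolding P_def using \<open>\<delta> > 0\<close> closest_point_lipschitz[of "cball c \<delta>" y z] by (simp add: dist_norm)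
    finally show ?thesis using \<open>L > 0\<close> by simp
  qed
  from ode_exists_global[of "\<lambda>z. F (P z)", OF this \<open>L > 0\<close>]
  obtain z where z: "z 0 = z0"
    "\<And>t. 0 \<le> t \<Longrightarrow> (z has_vector_derivative F (P (z t))) (at t within {0..})" by metis
  have z_at: "(z has_vector_derivative F (P (z t))) (at t)" if "0 < t" for t
    using z(2)[of t] at_within_interior[of t "{0..}"] that by simp
  have z_cont: "continuous_on {0..T} z" for T
  proof -
    have "continuous_on {0..} z"
      using z(2) by (auto simp: continuous_on_eq_continuous_within intro: has_vector_derivative_continuous)
    then show ?thesis by (rule continuous_on_subset) auto
  qed
  \<comment> \<open>The projected field takes its values from the ball, so it is orthogonal to
    \<open>w\<close> everywhere; the motion stays in the hyperplane where \<open>inward\<close> is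
    available.\<close>
  have w_cons: "w \<bullet> (z T - c) = 0" if "0 \<le> T" for T
  proof (cases "T = 0")
    case False
    with that have "0 < T" by simp
    have "w \<bullet> (z T - c) = w \<bullet> (z 0 - c)"
    proof (rule DERIV_isconst_end[OF \<open>0 < T\<close>])
      show "continuous_on {0..T} (\<lambda>t. w \<bullet> (z t - c))"
        by (intro continuous_intros z_cont)
      fix t assume t: "0 < t" "t < T"
      have "((\<lambda>t. w \<bullet> (z t - c)) has_derivative (\<lambda>h. w \<bullet> (h *\<^sub>R F (P (z t)) - 0))) (at t)"
        using z_at[OF t(1)] unfolding has_vector_derivative_def
        by (intro has_derivative_inner_right has_derivative_diff has_derivative_const)
      then show "((\<lambda>t. w \<bullet> (z t - c)) has_real_derivative 0) (at t)"
        using cons[OF P_in] by (simp add: has_field_derivative_def mult_zero_left[abs_def])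
    qed
    then show ?thesis using z0 z by simp
  qed (use z0 z in auto)
  \<comment> \<open>Outside the ball \<open>P p - c\<close> is a positive multiple of
    \<open>p - c\<close>. Hence \<open>P p\<close> lies in the same hyperplane, and the sign of the
    inner product carries over from \<open>P p\<close> to \<open>p\<close>.\<close>
  have inward': "(p - c) \<bullet> F (P p) \<le> 0" if "w \<bullet> (p - c) = 0" for p
  proof (cases "p \<in> cball c \<delta>")
    case True
    then have "P p = p" by (simp add: P_def closest_point_self)
    then show ?thesis using inward True that by simp
  next
    case False
    then have far: "\<delta> < norm (p - c)" by (simp add: dist_norm norm_minus_commute)
    then have Pp: "P p - c = (\<delta> / norm (p - c)) *\<^sub>R (p - c)"
      using \<open>\<delta> > 0\<close> by (simp add: P_def closest_point_cball)
    then have "(P p - c) \<bullet> F (P p) \<le> 0"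
      using that by (intro inward P_in) simp
    then have "(\<delta> / norm (p - c)) * ((p - c) \<bullet> F (P p)) \<le> 0"
      by (simp add: Pp)
    moreover have "\<delta> / norm (p - c) > 0"
      using \<open>\<delta> > 0\<close> far by (intro divide_pos_pos) auto
    ultimately show ?thesis using mult_le_cancel_left_pos[of "\<delta> / norm (p - c)" _ 0] by simp
  qed
  have z_in: "z T \<in> cball c \<delta>" if "0 \<le> T" for T
  proof -
    have "(norm (z T - c))\<^sup>2 \<le> exp (0 - 0) * (norm (z 0 - c))\<^sup>2"
    proof (rule gronwall_differential[where \<phi> = "\<lambda>_. 0" and \<phi>' = "\<lambda>_. 0"])
      fix t assume t: "0 < t" "t < T"
      have "((\<lambda>t. z t - c) has_vector_derivative F (P (z t))) (at t)"
        using has_vector_derivative_diff[OF z_at[OF t(1)] has_vector_derivative_const[of c]] by simp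
      then show "((\<lambda>t. (norm (z t - c))\<^sup>2) has_real_derivative 2 * ((z t - c) \<bullet> F (P (z t)))) (at t)"
        by (rule has_real_derivative_norm_power2)
      show "2 * ((z t - c) \<bullet> F (P (z t))) \<le> 0 * (norm (z t - c))\<^sup>2"
        using inward' w_cons t by simp
    qed (auto intro!: continuous_intros z_cont that)
    then have "norm (z T - c) \<le> norm (z 0 - c)"
      by (simp add: power_mono_iff)
    then show ?thesis using z0 z by (simp add: dist_norm norm_minus_commute)
  qed
  show thesis
  proof (rule that[of z])
    fix t :: real assume t: "0 \<le> t"
    have "P (z t) = z t" using z_in[OF t] by (simp add: P_def closest_point_self)
    then show "(z has_vector_derivative F (z t)) (at t within {0..})" using z(2)[OF t] by simp
  qed (use z z_in w_cons in auto)
qed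

text \<open>The cubic error only allows the rate \<open>\<mu> / 2\<close> at first.  Since the error is then integrable
  in time, a second application of Gronwall's inequality recovers the full rate \<open>\<mu>\<close>.\<close>

lemma exponential_decay:
  fixes F :: "'a::real_inner \<Rightarrow> 'a"
  assumes "\<mu> > 0" "\<delta> > 0" "K \<ge> 0" "K * \<delta> \<le> \<mu> / 2"
    and z: "\<And>t. 0 \<le> t \<Longrightarrow> (z has_vector_derivative F (z t)) (at t within {0..})"
    and z_in: "\<And>t. 0 \<le> t \<Longrightarrow> norm (z t - c) \<le> \<delta>"
    and energy: "\<And>t. 0 \<le> t \<Longrightarrow>
      (z t - c) \<bullet> F (z t) \<le> - \<mu> * (norm (z t - c))\<^sup>2 + K * (norm (z t - c))^3"
    and "0 \<le> T"
  shows "norm (z T - c) \<le> \<delta> * exp (1 - \<mu> * T)"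
proof -
  define E where "E t = (norm (z t - c))\<^sup>2" for t
  have E_cont: "continuous_on {0..T} E" for T
  proof -
    have "continuous_on {0..} z"
      using z by (auto simp: continuous_on_eq_continuous_within intro: has_vector_derivative_continuous)
    then have "continuous_on {0..T} z" by (rule continuous_on_subset) auto
    then show ?thesis unfolding E_def by (intro continuous_intros)
  qed
  have E_deriv: "(E has_real_derivative 2 * ((z t - c) \<bullet> F (z t))) (at t)" if "0 < t" for t
  proof -
    have "(z has_vector_derivative F (z t)) (at t)"
      using z[of t] at_within_interior[of t "{0..}"] that by simp
    then have "((\<lambda>t. z t - c) has_vector_derivative F (z t)) (at t)"
      using has_vector_derivative_diff[OF _ has_vector_derivative_const[of c], of z "F (z t)"] by simp
    then show ?thesis unfolding E_def by (rule has_real_derivative_norm_power2)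
  qed
  \<comment> \<open>One of the three factors in the cubic error is replaced by a bound \<rho>: first
    the constant \<delta>, then the decaying bound obtained from it.\<close>
  have E_le: "2 * ((z t - c) \<bullet> F (z t)) \<le> (- 2 * \<mu> + 2 * K * \<rho>) * E t"
    if "0 \<le> t" "norm (z t - c) \<le> \<rho>" for t \<rho>
  proof -
    have "K * E t * norm (z t - c) \<le> K * E t * \<rho>"
      using that \<open>K \<ge> 0\<close> by (intro mult_left_mono) (auto simp: E_def)
    then show ?thesis
      using energy[OF that(1)] by (simp add: E_def power3_eq_cube power2_eq_square algebra_simps)
  qed
  have E0: "E 0 \<le> \<delta>\<^sup>2" unfolding E_def using z_in[of 0] by (intro power_mono) auto
  \<comment> \<open>By \<open>K * \<delta> \<le> \<mu> / 2\<close> the error consumes at most half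
    of the rate \<open>2 * \<mu>\<close> of \<open>E\<close>; the remaining \<mu> is the rate
    \<open>\<mu> / 2\<close> for the norm.\<close>
  have half: "norm (z T - c) \<le> \<delta> * exp (- (\<mu> / 2) * T)" if "0 \<le> T" for T
  proof -
    have "E T \<le> exp (- \<mu> * T - (- \<mu> * 0)) * E 0"
    proof (rule gronwall_differential[where \<phi> = "\<lambda>t. - \<mu> * t" and \<phi>' = "\<lambda>_. - \<mu>", OF that E_cont])
      fix t assume t: "0 < t" "t < T"
      have "(- 2 * \<mu> + 2 * K * \<delta>) * E t \<le> - \<mu> * E t"
        using assms(4) by (intro mult_right_mono) (auto simp: E_def)
      then show "2 * ((z t - c) \<bullet> F (z t)) \<le> - \<mu> * E t"
        using E_le[of t \<delta>] z_in[of t] t by linarith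
    qed (auto intro!: derivative_eq_intros continuous_intros E_deriv)
    also have "\<dots> \<le> exp (- \<mu> * T) * \<delta>\<^sup>2"
      using E0 by simp
    also have "\<dots> = (\<delta> * exp (- (\<mu> / 2) * T))\<^sup>2"
      by (simp add: power_mult_distrib flip: exp_double)
    finally show ?thesis
      unfolding E_def using \<open>\<delta> > 0\<close> by (subst (asm) power_mono_iff) auto
  qed
  \<comment> \<open>A primitive of the rate that \<open>E_le\<close> gives for the decaying
    \<rho>.\<close>
  define \<phi> where "\<phi> t = - 2 * \<mu> * t - (4 * K * \<delta> / \<mu>) * exp (- (\<mu> / 2) * t)" for t
  have "E T \<le> exp (\<phi> T - \<phi> 0) * E 0"
  proof (rule gronwall_differential[where \<phi> = \<phi> and
        \<phi>' = "\<lambda>t. - 2 * \<mu> + 2 * K * (\<delta> * exp (- (\<mu> / 2) * t))", OF \<open>0 \<le> T\<close> E_cont])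
    fix t assume t: "0 < t" "t < T"
    show "2 * ((z t - c) \<bullet> F (z t)) \<le> (- 2 * \<mu> + 2 * K * (\<delta> * exp (- (\<mu> / 2) * t))) * E t"
      using t by (intro E_le half) auto
    show "(\<phi> has_real_derivative - 2 * \<mu> + 2 * K * (\<delta> * exp (- (\<mu> / 2) * t))) (at t)"
      unfolding \<phi>_def using \<open>\<mu> > 0\<close>
      by (auto intro!: derivative_eq_intros simp: field_simps)
  qed (auto intro!: continuous_intros E_deriv simp: \<phi>_def \<open>\<mu> > 0\<close>[THEN less_imp_neq, symmetric])
  \<comment> \<open>The total effect of the error over all times is at most
    \<open>4 * K * \<delta> / \<mu> \<le> 2\<close>; its square root is the factor
    \<open>exp 1\<close> in the conclusion.\<close>
  also have "\<dots> \<le> exp (2 - 2 * \<mu> * T) * \<delta>\<^sup>2"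
  proof (intro mult_mono E0)
    have "0 \<le> 4 * K * \<delta> / \<mu>" "4 * K * \<delta> / \<mu> \<le> 2"
      using assms(1-4) by (auto simp: field_simps)
    moreover from this(1) have "0 \<le> (4 * K * \<delta> / \<mu>) * exp (- (\<mu> / 2) * T)"
      by (intro mult_nonneg_nonneg) auto
    ultimately show "exp (\<phi> T - \<phi> 0) \<le> exp (2 - 2 * \<mu> * T)"
      by (simp add: \<phi>_def)
  qed (auto simp: E_def)
  also have "\<dots> = (\<delta> * exp (1 - \<mu> * T))\<^sup>2"
    by (simp add: power_mult_distrib flip: exp_double)
  finally show ?thesis
    unfolding E_def using \<open>\<delta> > 0\<close> by (subst (asm) power_mono_iff) auto
qed

section \<open>Bounded Lipschitz maps\<close>

text \<open>Bounded Lipschitz maps, unlike Lipschitz maps, are closed under products.\<close>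

definition bounded_lipschitz_on :: "'a::metric_space set \<Rightarrow> ('a \<Rightarrow> 'b::real_normed_vector) \<Rightarrow> bool"
  where "bounded_lipschitz_on S f \<longleftrightarrow> bounded (f ` S) \<and> (\<exists>L. L-lipschitz_on S f)"

lemma bounded_lipschitz_onE:
  assumes "bounded_lipschitz_on S f"
  obtains B L where "B > 0" "\<And>x. x \<in> S \<Longrightarrow> norm (f x) \<le> B"
    "L \<ge> 0" "\<And>x y. x \<in> S \<Longrightarrow> y \<in> S \<Longrightarrow> norm (f x - f y) \<le> L * dist x y"
proof -
  obtain B L where "B > 0" "\<forall>y\<in>f ` S. norm y \<le> B" "L-lipschitz_on S f"
    using assms unfolding bounded_lipschitz_on_def bounded_pos by blast
  then show thesis
    by (intro that[of B L]) (auto simp: lipschitz_on_def dist_norm)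
qed

lemma bounded_lipschitz_onI:
  assumes "\<And>x. x \<in> S \<Longrightarrow> norm (f x) \<le> B"
    and "L \<ge> 0" "\<And>x y. x \<in> S \<Longrightarrow> y \<in> S \<Longrightarrow> norm (f x - f y) \<le> L * dist x y"
  shows "bounded_lipschitz_on S f"
  using assms unfolding bounded_lipschitz_on_def bounded_iff lipschitz_on_def dist_norm by blast

lemma bounded_lipschitz_on_scaleR:
  assumes "bounded_lipschitz_on S f" "bounded_lipschitz_on S g"
  shows "bounded_lipschitz_on S (\<lambda>x. f x *\<^sub>R g x)"
proof -
  obtain B L where f: "B > 0" "\<And>x. x \<in> S \<Longrightarrow> norm (f x) \<le> B"
    "L \<ge> 0" "\<And>x y. x \<in> S \<Longrightarrow> y \<in> S \<Longrightarrow> norm (f x - f y) \<le> L * dist x y"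
    using assms(1) by (rule bounded_lipschitz_onE) blast
  obtain C M where g: "C > 0" "\<And>x. x \<in> S \<Longrightarrow> norm (g x) \<le> C"
    "M \<ge> 0" "\<And>x y. x \<in> S \<Longrightarrow> y \<in> S \<Longrightarrow> norm (g x - g y) \<le> M * dist x y"
    using assms(2) by (rule bounded_lipschitz_onE) blast
  show ?thesis
  proof (rule bounded_lipschitz_onI)
    show "norm (f x *\<^sub>R g x) \<le> B * C" if "x \<in> S" for x
      using f(1,2) g(1,2) that by (auto intro!: mult_mono)
    show "norm (f x *\<^sub>R g x - f y *\<^sub>R g y) \<le> (L * C + B * M) * dist x y"
      if "x \<in> S" "y \<in> S" for x y
    proof -
      have "f x *\<^sub>R g x - f y *\<^sub>R g y = (f x - f y) *\<^sub>R g x + f y *\<^sub>R (g x - g y)"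
        by (simp add: algebra_simps)
      also have "norm \<dots> \<le> norm (f x - f y) * norm (g x) + norm (f y) * norm (g x - g y)"
        by (metis norm_scaleR norm_triangle_ineq real_norm_def)
      also have "\<dots> \<le> (L * dist x y) * C + B * (M * dist x y)"
        using f g that by (intro add_mono mult_mono) auto
      finally show ?thesis by (simp add: algebra_simps)
    qed
    show "0 \<le> L * C + B * M" using f g by auto
  qed
qed

lemma bounded_lipschitz_on_add:
  assumes "bounded_lipschitz_on S f" "bounded_lipschitz_on S g"
  shows "bounded_lipschitz_on S (\<lambda>x. f x + g x)"
  using assms unfolding bounded_lipschitz_on_def
  by (auto intro: bounded_plus_comp lipschitz_on_add)

lemma bounded_lipschitz_on_const: "bounded_lipschitz_on S (\<lambda>x. c)"
  by (rule bounded_lipschitz_onI[of _ _ "norm c" 0]) auto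

lemma bounded_lipschitz_on_sum:
  assumes "\<And>i. i \<in> I \<Longrightarrow> bounded_lipschitz_on S (f i)"
  shows "bounded_lipschitz_on S (\<lambda>x. \<Sum>i\<in>I. f i x)"
  using assms
  by (induction I rule: infinite_finite_induct)
     (auto intro: bounded_lipschitz_on_add bounded_lipschitz_on_const)

lemma bounded_lipschitz_on_compose:
  assumes "bounded_lipschitz_on T g" "bounded_lipschitz_on S f" "f ` S \<subseteq> T"
  shows "bounded_lipschitz_on S (\<lambda>x. g (f x))"
proof -
  obtain B L where g: "B > 0" "\<And>x. x \<in> T \<Longrightarrow> norm (g x) \<le> B"
    "L \<ge> 0" "\<And>x y. x \<in> T \<Longrightarrow> y \<in> T \<Longrightarrow> norm (g x - g y) \<le> L * dist x y"
    using assms(1) by (rule bounded_lipschitz_onE) blast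
  obtain C M where f: "C > 0" "\<And>x. x \<in> S \<Longrightarrow> norm (f x) \<le> C"
    "M \<ge> 0" "\<And>x y. x \<in> S \<Longrightarrow> y \<in> S \<Longrightarrow> norm (f x - f y) \<le> M * dist x y"
    using assms(2) by (rule bounded_lipschitz_onE) blast
  show ?thesis
  proof (rule bounded_lipschitz_onI)
    show "norm (g (f x)) \<le> B" if "x \<in> S" for x
      using g(2) assms(3) that by blast
    show "norm (g (f x) - g (f y)) \<le> (L * M) * dist x y" if "x \<in> S" "y \<in> S" for x y
    proof -
      have "norm (g (f x) - g (f y)) \<le> L * dist (f x) (f y)"
        using g(4) assms(3) that by blast
      also have "\<dots> \<le> L * (M * dist x y)"
        using f(4)[OF that] g(3) by (intro mult_left_mono) (auto simp: dist_norm)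
      finally show ?thesis by simp
    qed
  qed (use f g in auto)
qed

lemma bounded_lipschitz_on_bounded_linear:
  assumes "bounded_linear h" "bounded S"
  shows "bounded_lipschitz_on S h"
  using bounded_linear_image[OF assms(2,1)] bounded_linear.lipschitz_boundE[OF assms(1)]
  unfolding bounded_lipschitz_on_def by metis

lemma bounded_lipschitz_on_norm:
  assumes "bounded_lipschitz_on S f"
  shows "bounded_lipschitz_on S (\<lambda>x. norm (f x))"
proof -
  obtain B L where "B > 0" "\<And>x. x \<in> S \<Longrightarrow> norm (f x) \<le> B"
    "L \<ge> 0" "\<And>x y. x \<in> S \<Longrightarrow> y \<in> S \<Longrightarrow> norm (f x - f y) \<le> L * dist x y"
    using assms by (rule bounded_lipschitz_onE) blast
  then show ?thesis
    by (intro bounded_lipschitz_onI[of _ _ B L]) (auto intro: order_trans[OF norm_triangle_ineq3])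
qed

lemma bounded_lipschitz_on_inverse:
  assumes "0 < (r::real)"
  shows "bounded_lipschitz_on {r..} inverse"
proof (rule bounded_lipschitz_onI)
  show "norm (inverse x) \<le> inverse r" if "x \<in> {r..}" for x
    using assms that by (auto intro: le_imp_inverse_le)
  show "norm (inverse x - inverse y) \<le> inverse r * inverse r * dist x y"
    if "x \<in> {r..}" "y \<in> {r..}" for x y
  proof -
    have "inverse x - inverse y = - (inverse x * (x - y) * inverse y)"
      using assms that by (intro inverse_diff_inverse) auto
    then have "norm (inverse x - inverse y) = (inverse x * inverse y) * dist x y"
      using assms that by (simp add: abs_mult dist_norm)
    also have "\<dots> \<le> (inverse r * inverse r) * dist x y"
      using assms that by (intro mult_right_mono mult_mono le_imp_inverse_le) auto
    finally show ?thesis .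
  qed
qed auto

lemma bounded_lipschitz_on_C1:
  fixes f :: "real \<Rightarrow> real"
  assumes "\<And>x. (f has_real_derivative f' x) (at x)" "continuous_on UNIV f'"
  shows "bounded_lipschitz_on {a..b} f"
proof -
  have "bounded (f ` {a..b})"
    using assms(1)
    by (intro compact_imp_bounded compact_continuous_image continuous_at_imp_continuous_on)
       (auto intro: DERIV_isCont)
  moreover have "bounded (f' ` {a..b})"
    by (intro compact_imp_bounded compact_continuous_image continuous_on_subset[OF assms(2)]) auto
  then obtain L where L: "L > 0" "\<And>x. x \<in> {a..b} \<Longrightarrow> norm (f' x) \<le> L"
    unfolding bounded_pos by auto
  have "L-lipschitz_on {a..b} f"
    using L field_differentiable_bound[OF convex_real_interval(5)
        has_field_derivative_at_within[OF assms(1)] L(2)]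
    by (intro lipschitz_onI) (auto simp: dist_norm)
  ultimately show ?thesis by (auto simp: bounded_lipschitz_on_def)
qed

section \<open>The grain boundary vector field\<close>

text \<open>The two evolution laws form one autonomous field on the product space, whose squared
  norm is the energy \<open>E\<close>. Division by zero makes the field total, so it has a value
  even at the vertices.\<close>

definition gb_field ::
  "real \<Rightarrow> real \<Rightarrow> (real \<Rightarrow> real) \<Rightarrow> real^2^3 \<Rightarrow> (real^3) \<times> (real^2) \<Rightarrow> (real^3) \<times> (real^2)"
  where "gb_field \<gamma> \<eta> \<sigma> x z =
    ((\<chi> j. - \<gamma> * (deriv \<sigma> (\<Delta> (j + 1) (fst z)) * norm (bvec x (snd z) (j + 1))
                 - deriv \<sigma> (\<Delta> j (fst z)) * norm (bvec x (snd z) j))),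
     \<eta> *\<^sub>R (\<Sum>j\<in>UNIV. \<sigma> (\<Delta> j (fst z)) *\<^sub>R (bvec x (snd z) j /\<^sub>R norm (bvec x (snd z) j))))"

text \<open>At distance \<open>r\<close> from the vertices the field is assembled by sums and
  products from linear maps, edge lengths, their inverses, and C^1 functions of the differences, all
  of them bounded and Lipschitz on a bounded set.\<close>

lemma gb_field_lipschitz:
  assumes "\<And>\<theta>. (\<sigma> has_real_derivative deriv \<sigma> \<theta>) (at \<theta>)"
    and "\<And>\<theta>. (deriv \<sigma> has_real_derivative \<sigma>2 \<theta>) (at \<theta>)" "continuous_on UNIV \<sigma>2"
    and S: "bounded S" and "0 < r" and away: "\<And>z j. z \<in> S \<Longrightarrow> r \<le> norm (bvec x (snd z) j)"
  obtains L where "L > 0"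
    "\<And>p q. p \<in> S \<Longrightarrow> q \<in> S \<Longrightarrow> norm (gb_field \<gamma> \<eta> \<sigma> x p - gb_field \<gamma> \<eta> \<sigma> x q) \<le> L * norm (p - q)"
proof -
  have deriv_cont: "continuous_on UNIV (deriv \<sigma>)"
    using assms(2) by (intro continuous_at_imp_continuous_on) (auto intro: DERIV_isCont)
  have \<Delta>: "bounded_lipschitz_on S (\<lambda>z. \<Delta> j (fst z))" for j
    unfolding \<Delta>_def
    by (intro bounded_lipschitz_on_bounded_linear S bounded_linear_sub
        bounded_linear_compose[OF bounded_linear_vec_nth bounded_linear_fst])
  have comp: "bounded_lipschitz_on S (\<lambda>z. f (\<Delta> j (fst z)))"
    if f: "\<And>a b. bounded_lipschitz_on {a..b} f" for f :: "real \<Rightarrow> real" and j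
  proof -
    \<comment> \<open>On \<open>S\<close> the differences stay in a compact interval, where a C^1
      function is bounded and Lipschitz.\<close>
    obtain B where "\<And>z. z \<in> S \<Longrightarrow> norm (\<Delta> j (fst z)) \<le> B"
      using \<Delta>[of j] by (rule bounded_lipschitz_onE) blast
    then have "(\<lambda>z. \<Delta> j (fst z)) ` S \<subseteq> {-B..B}" by (fastforce simp: abs_le_iff)
    then show ?thesis by (rule bounded_lipschitz_on_compose[OF f \<Delta>])
  qed
  have \<sigma>: "bounded_lipschitz_on S (\<lambda>z. \<sigma> (\<Delta> j (fst z)))" for j
    by (intro comp bounded_lipschitz_on_C1[OF assms(1) deriv_cont])
  have \<sigma>': "bounded_lipschitz_on S (\<lambda>z. deriv \<sigma> (\<Delta> j (fst z)))" for j
    by (intro comp bounded_lipschitz_on_C1[OF assms(2,3)])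
  have b: "bounded_lipschitz_on S (\<lambda>z. bvec x (snd z) j)" for j
  proof -
    have "bounded_lipschitz_on S (\<lambda>z. x $ j + (- snd z))"
      by (intro bounded_lipschitz_on_add bounded_lipschitz_on_const
          bounded_lipschitz_on_bounded_linear S bounded_linear_minus bounded_linear_snd)
    then show ?thesis by (simp add: bvec_def)
  qed
  have nb: "bounded_lipschitz_on S (\<lambda>z. norm (bvec x (snd z) j))" for j
    by (intro bounded_lipschitz_on_norm b)
  have inv: "bounded_lipschitz_on S (\<lambda>z. inverse (norm (bvec x (snd z) j)))" for j
    by (rule bounded_lipschitz_on_compose[OF bounded_lipschitz_on_inverse[OF \<open>0 < r\<close>] nb])
       (use away in auto)
  have flux: "bounded_lipschitz_on S (\<lambda>z. deriv \<sigma> (\<Delta> j (fst z)) *\<^sub>R norm (bvec x (snd z) j))" for j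
    by (intro bounded_lipschitz_on_scaleR \<sigma>' nb)
  \<comment> \<open>The component vector is expanded along \<open>axis j 1\<close>, with
    \<open>*\<^sub>R\<close> for every product and a factor -1 for the difference, so that it has
    the shape of the closure rules.\<close>
  have 1: "bounded_lipschitz_on S (\<lambda>z. \<Sum>j\<in>UNIV. (- \<gamma>) *\<^sub>R
      (deriv \<sigma> (\<Delta> (j + 1) (fst z)) *\<^sub>R norm (bvec x (snd z) (j + 1))
        + (- 1) *\<^sub>R (deriv \<sigma> (\<Delta> j (fst z)) *\<^sub>R norm (bvec x (snd z) j))) *\<^sub>R (axis j 1 :: real^3))"
    by (intro bounded_lipschitz_on_sum bounded_lipschitz_on_scaleR bounded_lipschitz_on_const
        bounded_lipschitz_on_add flux)
  have "bounded_lipschitz_on S (\<lambda>z. fst (gb_field \<gamma> \<eta> \<sigma> x z))"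
  proof -
    have "fst (gb_field \<gamma> \<eta> \<sigma> x z) = (\<Sum>j\<in>UNIV. (- \<gamma>) *\<^sub>R
      (deriv \<sigma> (\<Delta> (j + 1) (fst z)) *\<^sub>R norm (bvec x (snd z) (j + 1))
        + (- 1) *\<^sub>R (deriv \<sigma> (\<Delta> j (fst z)) *\<^sub>R norm (bvec x (snd z) j))) *\<^sub>R (axis j 1 :: real^3))" for z
      by (simp add: gb_field_def vec_eq_iff axis_def if_distrib sum.delta cong: if_cong)
    with 1 show ?thesis by simp
  qed
  moreover have "bounded_lipschitz_on S (\<lambda>z. snd (gb_field \<gamma> \<eta> \<sigma> x z))"
    unfolding gb_field_def snd_conv
    by (intro bounded_lipschitz_on_sum bounded_lipschitz_on_scaleR bounded_lipschitz_on_const \<sigma> inv b)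
  ultimately obtain L M where LM: "L-lipschitz_on S (\<lambda>z. fst (gb_field \<gamma> \<eta> \<sigma> x z))"
      "M-lipschitz_on S (\<lambda>z. snd (gb_field \<gamma> \<eta> \<sigma> x z))"
    by (auto simp: bounded_lipschitz_on_def)
  show thesis
  proof (rule that[of "L + M + 1"])
    \<comment> \<open>The summand 1 secures strict positivity, which the existence result
      demands.\<close>
    show "0 < L + M + 1" using LM[THEN lipschitz_on_nonneg] by simp
    fix p q assume pq: "p \<in> S" "q \<in> S"
    have "norm (gb_field \<gamma> \<eta> \<sigma> x p - gb_field \<gamma> \<eta> \<sigma> x q)
        \<le> norm (fst (gb_field \<gamma> \<eta> \<sigma> x p) - fst (gb_field \<gamma> \<eta> \<sigma> x q))
          + norm (snd (gb_field \<gamma> \<eta> \<sigma> x p) - snd (gb_field \<gamma> \<eta> \<sigma> x q))"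
      using norm_Pair_le[of "fst r" "snd r" for r, unfolded prod.collapse,
          of "gb_field \<gamma> \<eta> \<sigma> x p - gb_field \<gamma> \<eta> \<sigma> x q"]
      by simp
    also have "\<dots> \<le> L * norm (p - q) + M * norm (p - q)"
      using lipschitz_onD[OF LM(1) pq] lipschitz_onD[OF LM(2) pq] by (simp add: dist_norm)
    also have "\<dots> \<le> (L + M + 1) * norm (p - q)" by (simp add: algebra_simps)
    finally show "norm (gb_field \<gamma> \<eta> \<sigma> x p - gb_field \<gamma> \<eta> \<sigma> x q) \<le> (L + M + 1) * norm (p - q)" .
  qed
qed

section \<open>Spectral gaps and Taylor estimates\<close>

text \<open>The predecessor of the index 1 comes out as 0, which has to be renamed 3 to match the
  indices 1, 2, 3 of expanded sums.\<close>

lemma Delta_simps: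
  "\<Delta> 1 \<alpha> = \<alpha> $ 3 - \<alpha> $ 1" "\<Delta> 2 \<alpha> = \<alpha> $ 1 - \<alpha> $ 2" "\<Delta> 3 \<alpha> = \<alpha> $ 2 - \<alpha> $ 3"
proof -
  have "(0::3) = 3" by simp
  then show "\<Delta> 1 \<alpha> = \<alpha> $ 3 - \<alpha> $ 1" unfolding \<Delta>_def diff_self by (simp only:)
qed (simp_all add: \<Delta>_def)

lemma four_eq_one: "(4::3) = 1"
  by simp

text \<open>Completing the square after multiplication by \<open>a\<close>; for \<open>a = 0\<close>
  the discriminant condition forces \<open>b = 0\<close>.\<close>

lemma binary_quadratic_form_nonneg:
  fixes a b c X Y :: real
  assumes "0 \<le> a" "0 \<le> c" "b\<^sup>2 \<le> a * c"
  shows "0 \<le> a * X\<^sup>2 + 2 * b * X * Y + c * Y\<^sup>2"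
proof (cases "a = 0")
  case True
  with assms show ?thesis by simp
next
  case False
  have "a * (a * X\<^sup>2 + 2 * b * X * Y + c * Y\<^sup>2) = (a * X + b * Y)\<^sup>2 + (a * c - b\<^sup>2) * Y\<^sup>2"
    by (simp add: power2_eq_square algebra_simps)
  also have "\<dots> \<ge> 0" using assms by simp
  finally show ?thesis using False assms(1) by (simp add: zero_le_mult_iff)
qed

text \<open>Computed from the roots of the characteristic polynomial. With \<mu> the smaller root, A
  - \<mu> I has nonnegative diagonal and determinant zero, so its quadratic form is nonnegative.
  Exhibiting all candidates for eigenvalues also shows that the \<open>Min\<close> is taken over a
  finite set.\<close>

lemma smallest_eigenvalue_symmetric_2:
  fixes A :: "real^2^2"
  assumes sym: "A $ 1 $ 2 = A $ 2 $ 1"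
  shows "smallest_eigenvalue A * (norm v)\<^sup>2 \<le> v \<bullet> (A *v v)"
    and "\<exists>u. u \<noteq> 0 \<and> A *v u = smallest_eigenvalue A *\<^sub>R u"
proof -
  define p q r where "p = A $ 1 $ 1" and "q = A $ 1 $ 2" and "r = A $ 2 $ 2"
  note entries = p_def[symmetric] q_def[symmetric] r_def[symmetric] q_def[unfolded sym, symmetric]
  define D where "D = sqrt ((p - r)\<^sup>2 + 4 * q\<^sup>2)"
  define \<mu> where "\<mu> = (p + r - D) / 2"
  have D2: "D\<^sup>2 = (p - r)\<^sup>2 + 4 * q\<^sup>2" by (simp add: D_def)
  have D_ge: "\<bar>p - r\<bar> \<le> D" unfolding D_def by (rule real_le_rsqrt) simp
  have \<mu>_le: "\<mu> \<le> p" "\<mu> \<le> r" using D_ge by (auto simp: \<mu>_def field_simps)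
  have char: "(p - \<mu>) * (r - \<mu>) = q\<^sup>2"
    using D2 by (simp add: \<mu>_def power2_eq_square field_simps)
  define Ev where "Ev = {\<mu>. \<exists>v. v \<noteq> 0 \<and> A *v v = \<mu> *\<^sub>R v}"
  have Av: "A *v v = \<kappa> *\<^sub>R v \<longleftrightarrow>
      (p - \<kappa>) * v $ 1 + q * v $ 2 = 0 \<and> q * v $ 1 + (r - \<kappa>) * v $ 2 = 0" for v \<kappa>
    by (simp add: vec_eq_iff forall_2 matrix_vector_mult_def sum_2 entries algebra_simps)
  have ev: "\<kappa> \<in> {\<mu>, (p + r + D) / 2}" if Ev: "\<kappa> \<in> Ev" for \<kappa>
  proof -
    obtain v :: "real^2" where v: "v \<noteq> 0" "(p - \<kappa>) * v $ 1 + q * v $ 2 = 0" "q * v $ 1 + (r - \<kappa>) * v $ 2 = 0"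
      using Ev by (auto simp: Ev_def Av)
    \<comment> \<open>Cramer's rule: eliminating one coordinate multiplies the other by the
      determinant.\<close>
    have "((p - \<kappa>) * (r - \<kappa>) - q\<^sup>2) * v $ 1 = 0" "((p - \<kappa>) * (r - \<kappa>) - q\<^sup>2) * v $ 2 = 0"
      using v(2,3) by algebra+
    moreover have "v $ 1 \<noteq> 0 \<or> v $ 2 \<noteq> 0" using v(1) by (auto simp: vec_eq_iff forall_2)
    ultimately have "(p - \<kappa>) * (r - \<kappa>) - q\<^sup>2 = 0" by auto
    then have "(\<kappa> - \<mu>) * (\<kappa> - (p + r + D) / 2) = 0"
      using D2 by (simp add: \<mu>_def power2_eq_square field_simps)
    then show ?thesis by auto
  qed
  have "\<mu> \<in> Ev"
  proof -
    have "\<exists>v::real^2. v \<noteq> 0 \<and> (p - \<mu>) * v $ 1 + q * v $ 2 = 0 \<and> q * v $ 1 + (r - \<mu>) * v $ 2 = 0"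
    \<comment> \<open>\<open>(q, \<mu> - p)\<close> is orthogonal to the first row of A - \<mu> I,
      and by \<open>char\<close> to the second; it fails only when it is zero, and then
      \<open>(1, 0)\<close> serves.\<close>
    proof (cases "p - \<mu> = 0 \<and> q = 0")
      case True
      then show ?thesis
        by (intro exI[of _ "vector [1, 0] :: real^2"]) (auto simp: vec_eq_iff forall_2)
    next
      case False
      then show ?thesis using char
        by (intro exI[of _ "vector [q, \<mu> - p] :: real^2"])
           (auto simp: vec_eq_iff forall_2 power2_eq_square algebra_simps)
    qed
    then show ?thesis using Av by (auto simp: Ev_def)
  qed
  moreover have "finite Ev"
    using ev finite_subset[of Ev "{\<mu>, (p + r + D) / 2}"] by blast
  moreover have "\<mu> \<le> \<kappa>" if "\<kappa> \<in> Ev" for \<kappa>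
  proof -
    have "0 \<le> D" by (simp add: D_def)
    then have "\<mu> \<le> (p + r + D) / 2" by (simp add: \<mu>_def)
    then show ?thesis using ev[OF that] by auto
  qed
  ultimately have small: "smallest_eigenvalue A = \<mu>"
    unfolding smallest_eigenvalue_def Ev_def[symmetric] by (intro Min_eqI) auto
  show "\<exists>u. u \<noteq> 0 \<and> A *v u = smallest_eigenvalue A *\<^sub>R u"
    using \<open>\<mu> \<in> Ev\<close> by (simp add: small Ev_def)
  have "0 \<le> (p - \<mu>) * (v $ 1)\<^sup>2 + 2 * q * v $ 1 * v $ 2 + (r - \<mu>) * (v $ 2)\<^sup>2"
    using \<mu>_le char by (intro binary_quadratic_form_nonneg) auto
  moreover have "v \<bullet> (A *v v) = p * (v $ 1)\<^sup>2 + 2 * q * v $ 1 * v $ 2 + r * (v $ 2)\<^sup>2"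
    by (simp add: inner_vec_def sum_2 matrix_vector_mult_def entries power2_eq_square algebra_simps)
  moreover have "(norm v)\<^sup>2 = (v $ 1)\<^sup>2 + (v $ 2)\<^sup>2"
    unfolding power2_norm_eq_inner by (simp add: inner_vec_def sum_2 power2_eq_square)
  ultimately show "smallest_eigenvalue A * (norm v)\<^sup>2 \<le> v \<bullet> (A *v v)"
    by (simp add: small algebra_simps)
qed

text \<open>The square of the sum of the lengths exceeds the radicand by three times the sum of
  their pairwise products.\<close>

lemma lambda1_pos:
  assumes "\<And>j. a \<noteq> x $ j"
  shows "0 < lambda1 x a"
proof -
  define b where "b j = norm (bvec x a j)" for j
  have pos: "0 < b j" for j using assms[of j] by (simp add: b_def bvec_def)
  have "sqrt (1/2 * ((b 1 - b 2)\<^sup>2 + (b 2 - b 3)\<^sup>2 + (b 3 - b 1)\<^sup>2)) < b 1 + b 2 + b 3"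
  proof (rule real_less_lsqrt)
    have eq: "(b 1 + b 2 + b 3)\<^sup>2 - 1/2 * ((b 1 - b 2)\<^sup>2 + (b 2 - b 3)\<^sup>2 + (b 3 - b 1)\<^sup>2)
        = 3 * (b 1 * b 2 + b 2 * b 3 + b 3 * b 1)"
      by (simp add: power2_eq_square algebra_simps)
    have "0 < b 1 * b 2 + b 2 * b 3 + b 3 * b 1"
      using pos by (intro add_pos_pos mult_pos_pos)
    then have "0 < (b 1 + b 2 + b 3)\<^sup>2 - 1/2 * ((b 1 - b 2)\<^sup>2 + (b 2 - b 3)\<^sup>2 + (b 3 - b 1)\<^sup>2)"
      unfolding eq by simp
    then show "1/2 * ((b 1 - b 2)\<^sup>2 + (b 2 - b 3)\<^sup>2 + (b 3 - b 1)\<^sup>2) < (b 1 + b 2 + b 3)\<^sup>2"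
      by (simp only: diff_gt_0_iff_gt)
  qed (use pos[of 1] pos[of 2] pos[of 3] in auto)
  then show ?thesis by (simp add: lambda1_def b_def)
qed

text \<open>\<open>lambda1\<close> is the spectral gap of the Laplacian of the triangle graph with edge
  weights \<open>\<bar>b\<^sub>j\<bar>\<close>.\<close>

lemma lambda1_poincare:
  assumes mean: "u $ 1 + u $ 2 + u $ 3 = 0"
  shows "lambda1 x a * (norm u)\<^sup>2 \<le> (\<Sum>j\<in>UNIV. norm (bvec x a j) * (\<Delta> j u)\<^sup>2)"
proof -
  define p q r where "p = norm (bvec x a 1)" and "q = norm (bvec x a 2)" and "r = norm (bvec x a 3)"
  define s e where "s = p + q + r" and "e = p * q + q * r + r * p"
  define R where "R = sqrt (1/2 * ((p - q)\<^sup>2 + (q - r)\<^sup>2 + (r - p)\<^sup>2))"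
  define l where "l = lambda1 x a"
  have l: "l = s - R" by (simp add: l_def lambda1_def p_def q_def r_def R_def s_def)
  have "R\<^sup>2 = 1/2 * ((p - q)\<^sup>2 + (q - r)\<^sup>2 + (r - p)\<^sup>2)"
    unfolding R_def by (rule real_sqrt_pow2) simp
  then have R2: "R\<^sup>2 = s\<^sup>2 - 3 * e"
    by (simp add: s_def e_def power2_eq_square algebra_simps)
  \<comment> \<open>A vector of mean zero is determined by two of its differences, so the claim
    becomes the nonnegativity of a binary quadratic form.\<close>
  define X Y where "X = \<Delta> 1 u" and "Y = \<Delta> 2 u"
  have Z: "\<Delta> 3 u = - (X + Y)" by (simp add: X_def Y_def Delta_simps)
  have u: "u $ 1 = (Y - X) / 3" "u $ 2 = - (X + 2 * Y) / 3" "u $ 3 = (2 * X + Y) / 3"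
    using mean by (auto simp: X_def Y_def Delta_simps)
  have norm_u: "(norm u)\<^sup>2 = 2/3 * (X\<^sup>2 + X * Y + Y\<^sup>2)"
    unfolding power2_norm_eq_inner
    by (simp add: inner_vec_def sum_3 u power2_eq_square field_simps)
  \<comment> \<open>The squares differ by \<open>3 * (p - r)\<^sup>2\<close> and
    \<open>3 * (q - r)\<^sup>2\<close>. These bounds make the diagonal coefficients of the form
    nonnegative.\<close>
  have R_ge: "\<bar>2 * q - p - r\<bar> \<le> 2 * R" "\<bar>2 * p - q - r\<bar> \<le> 2 * R"
  proof -
    have "(2 * q - p - r)\<^sup>2 \<le> (2 * R)\<^sup>2"
      using zero_le_power2[of "p - r"] unfolding power_mult_distrib R2
      by (simp add: s_def e_def power2_eq_square algebra_simps)
    then show "\<bar>2 * q - p - r\<bar> \<le> 2 * R"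
      by (subst (asm) abs_le_square_iff[symmetric]) (simp add: R_def)
    have "(2 * p - q - r)\<^sup>2 \<le> (2 * R)\<^sup>2"
      using zero_le_power2[of "q - r"] unfolding power_mult_distrib R2
      by (simp add: s_def e_def power2_eq_square algebra_simps)
    then show "\<bar>2 * p - q - r\<bar> \<le> 2 * R"
      by (subst (asm) abs_le_square_iff[symmetric]) (simp add: R_def)
  qed
  have "0 \<le> (p + r - 2/3 * l) * X\<^sup>2 + 2 * (r - l / 3) * X * Y + (q + r - 2/3 * l) * Y\<^sup>2"
  \<comment> \<open>\<open>l\<close> is the smaller root of
    \<open>l\<^sup>2 - 2 * s * l + 3 * e\<close>, the characteristic polynomial of the Laplacian on
    mean-zero vectors; hence the determinant of the form vanishes.\<close>
  proof (rule binary_quadratic_form_nonneg)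
    show "0 \<le> p + r - 2/3 * l" "0 \<le> q + r - 2/3 * l"
      using R_ge by (auto simp: l s_def)
    have "l\<^sup>2 - 2 * s * l + 3 * e = 0"
      using R2 by (simp add: l power2_eq_square algebra_simps)
    then have "(p + r - 2/3 * l) * (q + r - 2/3 * l) = (r - l / 3)\<^sup>2"
      by (simp add: s_def e_def power2_eq_square field_simps)
    then show "(r - l / 3)\<^sup>2 \<le> (p + r - 2/3 * l) * (q + r - 2/3 * l)" by simp
  qed
  moreover have "(\<Sum>j\<in>UNIV. norm (bvec x a j) * (\<Delta> j u)\<^sup>2) = p * X\<^sup>2 + q * Y\<^sup>2 + r * (X + Y)\<^sup>2"
    by (simp add: sum_3 Z p_def q_def r_def X_def Y_def power2_eq_square algebra_simps)
  ultimately show ?thesis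
    unfolding l_def[symmetric] norm_u
    by (simp add: power2_eq_square algebra_simps add_divide_distrib)
qed

lemma L_mat_symmetric: "L_mat x a $ 1 $ 2 = L_mat x a $ 2 $ 1"
  by (simp add: L_mat_def outer_product_def mat_def mult.commute)

text \<open>Away from the vertices each summand is the squared part of \<open>v\<close> orthogonal
  to the edge, divided by the edge length: exactly the second-order term of
  \<open>inner_normalized_taylor\<close>.\<close>

lemma L_mat_quadratic_form:
  "v \<bullet> (L_mat x a *v v) =
    (\<Sum>j\<in>UNIV. ((norm v)\<^sup>2 - (v \<bullet> bvec x a j)\<^sup>2 / (norm (bvec x a j))\<^sup>2) / norm (bvec x a j))"
proof -
  have *: "v \<bullet> ((c *\<^sub>R (mat 1 - outer_product (b /\<^sub>R n) (b /\<^sub>R n))) *v v) = c * ((norm v)\<^sup>2 - (v \<bullet> b)\<^sup>2 / n\<^sup>2)"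
    for b v :: "real^2" and c n :: real
    unfolding power2_norm_eq_inner
    by (simp add: inner_vec_def sum_2 matrix_vector_mult_def outer_product_def mat_def
        power2_eq_square divide_simps) (simp add: algebra_simps)
  show ?thesis
    unfolding L_mat_def sum_3 matrix_vector_mult_add_rdistrib inner_add_right * by simp
qed

lemma lambda2_le: "lambda2 x a * (norm v)\<^sup>2 \<le> v \<bullet> (L_mat x a *v v)"
  unfolding lambda2_def by (rule smallest_eigenvalue_symmetric_2(1)[OF L_mat_symmetric])

text \<open>A null vector of \<open>L_mat\<close> is parallel to all three unit vectors \<open>b\<^sub>j / \<bar>b\<^sub>j\<bar>\<close>, whose sum
  could then not vanish, the sum of three signs being odd.\<close>

lemma lambda2_pos:
  assumes "equilibrium_point x a"
  shows "0 < lambda2 x a"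
proof (rule ccontr)
  assume "\<not> 0 < lambda2 x a"
  then have neg: "lambda2 x a \<le> 0" by simp
  obtain v where v: "v \<noteq> 0" "L_mat x a *v v = lambda2 x a *\<^sub>R v"
    using smallest_eigenvalue_symmetric_2(2)[OF L_mat_symmetric, of x a] unfolding lambda2_def by blast
  define b where "b = bvec x a"
  have b: "0 < norm (b j)" for j
    using assms by (auto simp: b_def bvec_def equilibrium_point_def)
  define T where "T j = ((norm v)\<^sup>2 - (v \<bullet> b j)\<^sup>2 / (norm (b j))\<^sup>2) / norm (b j)" for j
  have cs: "(v \<bullet> b j)\<^sup>2 / (norm (b j))\<^sup>2 \<le> (norm v)\<^sup>2" for j
  proof -
    have "(v \<bullet> b j)\<^sup>2 \<le> (norm v * norm (b j))\<^sup>2"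
      using Cauchy_Schwarz_ineq2[of v "b j"] by (metis abs_ge_zero power2_abs power_mono)
    then show ?thesis using b[of j] by (simp add: divide_le_eq power_mult_distrib)
  qed
  then have T: "0 \<le> T j" for j using b[of j] by (simp add: T_def)
  have "(\<Sum>j\<in>UNIV. T j) = lambda2 x a * (v \<bullet> v)"
    using L_mat_quadratic_form[of v x a] v(2) by (simp add: T_def b_def)
  also have "\<dots> \<le> 0" using neg by (simp add: mult_nonpos_nonneg)
  \<comment> \<open>Nonnegative terms with nonpositive sum all vanish, which is equality in
    Cauchy-Schwarz for each edge.\<close>
  finally have T0: "T j = 0" for j
    using T by (metis UNIV_I finite sum_nonneg_eq_0_iff sum_nonneg order_antisym)
  have sq: "((v \<bullet> b j) / norm (b j))\<^sup>2 = (norm v)\<^sup>2" for j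
    using T0[of j] b[of j] by (simp add: T_def power_divide)
  have sign: "(v \<bullet> b j) / norm (b j) = norm v \<or> (v \<bullet> b j) / norm (b j) = - norm v" for j
    using sq[of j] by (simp add: power2_eq_iff)
  have "(v \<bullet> b 1) / norm (b 1) + (v \<bullet> b 2) / norm (b 2) + (v \<bullet> b 3) / norm (b 3)
      = v \<bullet> (\<Sum>j\<in>UNIV. b j /\<^sub>R norm (b j))"
    by (simp add: sum_3 inner_add_right divide_inverse mult.commute)
  also have "\<dots> = 0" using assms by (simp add: b_def equilibrium_point_def)
  finally show False using sign[of 1] sign[of 2] sign[of 3] v(1) by auto
qed

section \<open>Taylor estimates with explicit remainders\<close>

text \<open>Summed over the three edges, the linear terms will cancel at the equilibrium and the
  quadratic ones form \<open>L_mat\<close>. No derivatives are taken: the law of cosines gives the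
  difference of the inverse lengths exactly, and the remainder splits into three cubic
  terms.\<close>

lemma inner_normalized_taylor:
  fixes v b :: "'a::real_inner"
  assumes "b \<noteq> 0" "norm v \<le> norm b / 2"
  shows "(v \<bullet> (b - v)) / norm (b - v) \<le>
    (v \<bullet> b) / norm b - ((norm v)\<^sup>2 - (v \<bullet> b)\<^sup>2 / (norm b)\<^sup>2) / norm b + 8 / (norm b)\<^sup>2 * (norm v)^3"
proof -
  define m n s p where "m = norm b" and "n = norm (b - v)" and "s = norm v" and "p = v \<bullet> b"
  have m: "0 < m" using assms by (simp add: m_def)
  have s: "0 \<le> s" by (simp add: s_def)
  have mn: "\<bar>m - n\<bar> \<le> s" using norm_triangle_ineq3[of b "b - v"] by (simp add: m_def n_def s_def)
  then have n2: "m / 2 \<le> n" using assms(2) by (simp add: m_def s_def)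
  with m have n: "0 < n" by simp
  have p: "\<bar>p\<bar> \<le> m * s" using Cauchy_Schwarz_ineq2[of v b] by (simp add: p_def m_def s_def mult.commute)
  have law: "(m - n) * (m + n) = 2 * p - s\<^sup>2"
  proof -
    have "n\<^sup>2 = m\<^sup>2 - 2 * p + s\<^sup>2"
      unfolding n_def m_def s_def p_def power2_norm_eq_inner
      by (simp add: inner_diff inner_commute)
    then show ?thesis by (simp add: power2_eq_square algebra_simps)
  qed
  have inv: "1 / n - 1 / m = (2 * p - s\<^sup>2) / (m * n * (m + n))"
    using m n by (simp add: law[symmetric] divide_simps)
  \<comment> \<open>The two fractions agree for \<open>n = m\<close>; the factor
    \<open>m - n\<close> supplies the missing third order.\<close>
  have split: "2 / (m * n * (m + n)) - 1 / m^3 = (m - n) * (2 * m + n) / (m^3 * n * (m + n))"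
  proof -
    have "m + n \<noteq> 0" using m n by simp
    then show ?thesis using m n
      by (simp add: divide_simps power3_eq_cube) (simp add: algebra_simps)
  qed
  have "(p - s\<^sup>2) / n - p / m + (s\<^sup>2 - p\<^sup>2 / m\<^sup>2) / m
      = p * (1 / n - 1 / m) - p\<^sup>2 / m^3 + s\<^sup>2 * (1 / m - 1 / n)"
    using m n by (simp add: divide_simps power2_eq_square power3_eq_cube) (simp add: algebra_simps)?
  also have "\<dots> = - (p * s\<^sup>2 / (m * n * (m + n))) + p\<^sup>2 * (2 / (m * n * (m + n)) - 1 / m^3)
      + s\<^sup>2 * (n - m) / (m * n)"
  proof -
    have "p * (1 / n - 1 / m) = - (p * s\<^sup>2 / (m * n * (m + n))) + p\<^sup>2 * (2 / (m * n * (m + n)))"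
      unfolding inv by (simp add: power2_eq_square diff_divide_distrib right_diff_distrib)
    moreover have "1 / m - 1 / n = (n - m) / (m * n)" using m n by (simp add: field_simps)
    ultimately show ?thesis by (simp add: right_diff_distrib)
  qed
  \<comment> \<open>Each term is estimated with \<open>\<bar>m - n\<bar> \<le> s\<close>,
    \<open>\<bar>p\<bar> \<le> m * s\<close> or \<open>m / 2 \<le> n\<close>, which yields the
    constant 8 = 2 + 4 + 2.\<close>
  also have "\<dots> \<le> 2 / m\<^sup>2 * s^3 + 4 / m\<^sup>2 * s^3 + 2 / m\<^sup>2 * s^3"
  proof (intro add_mono)
    have "- (p * s\<^sup>2 / (m * n * (m + n))) \<le> (m * s) * s\<^sup>2 / (m * n * (m + n))"
    proof -
      have "(- p) * s\<^sup>2 / (m * n * (m + n)) \<le> (m * s) * s\<^sup>2 / (m * n * (m + n))"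
        using p m n by (intro divide_right_mono mult_right_mono) auto
      then show ?thesis by simp
    qed
    also have "\<dots> = s^3 / (n * (m + n))"
      using m by (simp add: power2_eq_square power3_eq_cube)
    also have "\<dots> \<le> s^3 / ((m / 2) * m)"
      using s m n n2 by (intro divide_left_mono mult_mono) auto
    finally show "- (p * s\<^sup>2 / (m * n * (m + n))) \<le> 2 / m\<^sup>2 * s^3"
      by (simp add: power2_eq_square mult.commute)
    have "p\<^sup>2 * (2 / (m * n * (m + n)) - 1 / m^3) = p\<^sup>2 * ((m - n) * ((2 * m + n) / (m + n))) / (m^3 * n)"
      unfolding split by simp
    also have "\<dots> \<le> (m * s)\<^sup>2 * (s * 2) / (m^3 * n)"
    proof (rule divide_right_mono)
      have "(m - n) * ((2 * m + n) / (m + n)) \<le> \<bar>m - n\<bar> * ((2 * m + n) / (m + n))"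
        using m n by (intro mult_right_mono) auto
      also have "\<dots> \<le> s * 2"
        using mn s m n by (intro mult_mono) (auto simp: divide_le_eq)
      finally have "p\<^sup>2 * ((m - n) * ((2 * m + n) / (m + n))) \<le> p\<^sup>2 * (s * 2)"
        by (rule mult_left_mono) simp
      also have "\<dots> \<le> (m * s)\<^sup>2 * (s * 2)"
        using p s power_mono[of "\<bar>p\<bar>" "m * s" 2] by (intro mult_right_mono) auto
      finally show "p\<^sup>2 * ((m - n) * ((2 * m + n) / (m + n))) \<le> (m * s)\<^sup>2 * (s * 2)" .
    qed (use m n in auto)
    also have "\<dots> = 2 * s^3 / (m * n)"
      using m n by (simp add: power2_eq_square power3_eq_cube field_simps)
    also have "\<dots> \<le> 2 * s^3 / (m * (m / 2))"
      using s m n n2 by (intro divide_left_mono mult_mono) auto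
    finally show "p\<^sup>2 * (2 / (m * n * (m + n)) - 1 / m^3) \<le> 4 / m\<^sup>2 * s^3"
      by (simp add: power2_eq_square mult.commute)
    have "s\<^sup>2 * (n - m) / (m * n) \<le> s\<^sup>2 * s / (m * n)"
      using mn m n by (intro divide_right_mono mult_left_mono) auto
    also have "\<dots> \<le> s\<^sup>2 * s / (m * (m / 2))"
      using s m n n2 by (intro divide_left_mono mult_mono) auto
    finally show "s\<^sup>2 * (n - m) / (m * n) \<le> 2 / m\<^sup>2 * s^3"
      by (simp add: power2_eq_square power3_eq_cube mult.commute)
  qed
  finally have "(p - s\<^sup>2) / n \<le> p / m - (s\<^sup>2 - p\<^sup>2 / m\<^sup>2) / m + 8 / m\<^sup>2 * s^3"
    by (simp add: algebra_simps)
  moreover have "v \<bullet> (b - v) = p - s\<^sup>2"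
    by (simp add: p_def s_def power2_norm_eq_inner inner_diff_right)
  ultimately show ?thesis by (simp add: m_def n_def s_def p_def)
qed

lemma C_diff_3D:
  assumes "C_diff 3 \<sigma>"
  obtains \<sigma>3 where "\<And>\<theta>. (\<sigma> has_real_derivative deriv \<sigma> \<theta>) (at \<theta>)"
    "\<And>\<theta>. (deriv \<sigma> has_real_derivative deriv (deriv \<sigma>) \<theta>) (at \<theta>)"
    "\<And>\<theta>. (deriv (deriv \<sigma>) has_real_derivative \<sigma>3 \<theta>) (at \<theta>)"
    "continuous_on UNIV \<sigma>3"
proof -
  have D: "\<exists>D. (\<forall>\<theta>. ((deriv ^^ k) \<sigma> has_real_derivative D \<theta>) (at \<theta>)) \<and> continuous_on UNIV D" if "k < 3" for k
    using assms that unfolding C_diff_def C1_differentiable_on_def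
    by (auto simp: has_real_derivative_iff_has_vector_derivative)
  have deriv_eq: "\<And>\<theta>. (f has_real_derivative deriv f \<theta>) (at \<theta>)" if "\<forall>\<theta>. (f has_real_derivative D \<theta>) (at \<theta>)" for f D
    using that DERIV_imp_deriv by metis
  obtain D0 D1 D2 where "\<forall>\<theta>. (\<sigma> has_real_derivative D0 \<theta>) (at \<theta>)"
    "\<forall>\<theta>. (deriv \<sigma> has_real_derivative D1 \<theta>) (at \<theta>)"
    "\<forall>\<theta>. (deriv (deriv \<sigma>) has_real_derivative D2 \<theta>) (at \<theta>)" "continuous_on UNIV D2"
    using D[of 0] D[of 1] D[of 2] by (auto simp: numeral_2_eq_2)
  then show thesis using that deriv_eq by blast
qed

text \<open>Mean value theorem on \<open>[-1, 1]\<close>: \<open>B\<close> bounds the second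
  derivative there and \<open>L\<close> is its Lipschitz constant, available because the third
  derivative is continuous. Since \<open>\<sigma>1 0 = 0\<close>, the first derivative is of order
  \<theta>, so \<sigma> deviates from \<open>\<sigma> 0\<close> only quadratically.\<close>

lemma sigma_taylor:
  assumes d1: "\<And>\<theta>. (\<sigma> has_real_derivative \<sigma>1 \<theta>) (at \<theta>)"
    and d2: "\<And>\<theta>. (\<sigma>1 has_real_derivative \<sigma>2 \<theta>) (at \<theta>)"
    and d3: "\<And>\<theta>. (\<sigma>2 has_real_derivative \<sigma>3 \<theta>) (at \<theta>)" "continuous_on UNIV \<sigma>3"
    and zero: "\<sigma>1 0 = 0"
  obtains M where "M > 0"
    "\<And>\<theta>. \<bar>\<theta>\<bar> \<le> 1 \<Longrightarrow> \<sigma>1 \<theta> * \<theta> \<ge> \<sigma>2 0 * \<theta>\<^sup>2 - M * \<bar>\<theta>\<bar>^3"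
    "\<And>\<theta>. \<bar>\<theta>\<bar> \<le> 1 \<Longrightarrow> \<sigma>1 \<theta> * \<theta> \<le> M * \<theta>\<^sup>2"
    "\<And>\<theta>. \<bar>\<theta>\<bar> \<le> 1 \<Longrightarrow> \<bar>\<sigma> \<theta> - \<sigma> 0\<bar> \<le> M * \<theta>\<^sup>2"
proof -
  obtain B L where BL: "B > 0" "\<And>\<theta>. \<theta> \<in> {-1..1} \<Longrightarrow> norm (\<sigma>2 \<theta>) \<le> B"
    "L \<ge> 0" "\<And>\<theta> \<phi>. \<theta> \<in> {-1..1} \<Longrightarrow> \<phi> \<in> {-1..1} \<Longrightarrow> norm (\<sigma>2 \<theta> - \<sigma>2 \<phi>) \<le> L * dist \<theta> \<phi>"
    using bounded_lipschitz_on_C1[OF d3, of "-1" 1] by (rule bounded_lipschitz_onE) blast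
  \<comment> \<open>A form of the mean value theorem at 0 that covers both signs of
    \<theta>.\<close>
  have mvt: "\<exists>\<xi>. \<bar>\<xi>\<bar> \<le> \<bar>\<theta>\<bar> \<and> f \<theta> - f 0 = f' \<xi> * \<theta>"
    if D: "\<And>\<theta>. (f has_real_derivative f' \<theta>) (at \<theta>)" for f f' :: "real \<Rightarrow> real" and \<theta>
  proof (cases \<theta> "0::real" rule: linorder_cases)
    case less
    then obtain \<xi> where "\<theta> < \<xi>" "\<xi> < 0" "f 0 - f \<theta> = (0 - \<theta>) * f' \<xi>"
      using MVT2[of \<theta> 0 f f'] D by blast
    then show ?thesis by (intro exI[of _ \<xi>]) (auto simp: algebra_simps)
  next
    case greater
    then obtain \<xi> where "0 < \<xi>" "\<xi> < \<theta>" "f \<theta> - f 0 = (\<theta> - 0) * f' \<xi>"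
      using MVT2[of 0 \<theta> f f'] D by blast
    then show ?thesis by (intro exI[of _ \<xi>]) (auto simp: algebra_simps)
  qed auto
  have s1: "\<bar>\<sigma>1 \<theta>\<bar> \<le> B * \<bar>\<theta>\<bar>" if "\<bar>\<theta>\<bar> \<le> 1" for \<theta>
  proof -
    obtain \<xi> where \<xi>: "\<bar>\<xi>\<bar> \<le> \<bar>\<theta>\<bar>" "\<sigma>1 \<theta> = \<sigma>2 \<xi> * \<theta>" using mvt[OF d2, of \<theta>] zero by auto
    then have "\<bar>\<sigma>2 \<xi>\<bar> \<le> B" using BL(2)[of \<xi>] that by (auto simp: abs_le_iff)
    then show ?thesis using \<xi>(2) by (auto simp: abs_mult intro: mult_right_mono)
  qed
  show thesis
  proof (rule that[of "B + L"])
    show "0 < B + L" using BL(1,3) by simp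
    fix \<theta> :: real assume \<theta>: "\<bar>\<theta>\<bar> \<le> 1"
    obtain \<xi> where \<xi>: "\<bar>\<xi>\<bar> \<le> \<bar>\<theta>\<bar>" "\<sigma>1 \<theta> = \<sigma>2 \<xi> * \<theta>" using mvt[OF d2, of \<theta>] zero by auto
    have "\<xi> \<in> {-1..1}" using \<xi>(1) \<theta> by (simp add: abs_le_iff) linarith
    then have "\<bar>\<sigma>2 \<xi> - \<sigma>2 0\<bar> \<le> L * \<bar>\<xi>\<bar>" using BL(4)[of \<xi> 0] by simp
    also have "\<dots> \<le> (B + L) * \<bar>\<theta>\<bar>" using \<xi>(1) BL(1,3) by (intro mult_mono) auto
    finally have "\<sigma>2 0 - (B + L) * \<bar>\<theta>\<bar> \<le> \<sigma>2 \<xi>" by linarith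
    then have "(\<sigma>2 0 - (B + L) * \<bar>\<theta>\<bar>) * \<theta>\<^sup>2 \<le> \<sigma>2 \<xi> * \<theta>\<^sup>2" by (rule mult_right_mono) simp
    moreover have "\<bar>\<theta>\<bar>^3 = \<bar>\<theta>\<bar> * \<theta>\<^sup>2" by (simp add: power3_eq_cube power2_eq_square)
    ultimately show "\<sigma>2 0 * \<theta>\<^sup>2 - (B + L) * \<bar>\<theta>\<bar>^3 \<le> \<sigma>1 \<theta> * \<theta>"
      using \<xi>(2) by (simp add: power2_eq_square algebra_simps)
    have "\<sigma>1 \<theta> * \<theta> \<le> \<bar>\<sigma>1 \<theta>\<bar> * \<bar>\<theta>\<bar>" by (metis abs_ge_self abs_mult)
    also have "\<dots> \<le> ((B + L) * \<bar>\<theta>\<bar>) * \<bar>\<theta>\<bar>"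
      using s1[OF \<theta>] BL(3) by (intro mult_right_mono) (auto simp: distrib_right intro: add_increasing2)
    finally show "\<sigma>1 \<theta> * \<theta> \<le> (B + L) * \<theta>\<^sup>2" by (simp add: power2_eq_square mult.assoc)
    obtain \<xi> where \<xi>: "\<bar>\<xi>\<bar> \<le> \<bar>\<theta>\<bar>" "\<sigma> \<theta> - \<sigma> 0 = \<sigma>1 \<xi> * \<theta>" using mvt[OF d1, of \<theta>] by auto
    have "\<bar>\<sigma>1 \<xi>\<bar> \<le> B * \<bar>\<xi>\<bar>" using s1 \<xi>(1) \<theta> by auto
    also have "\<dots> \<le> (B + L) * \<bar>\<theta>\<bar>" using \<xi>(1) BL(1,3) by (intro mult_mono) auto
    finally have "\<bar>\<sigma>1 \<xi>\<bar> * \<bar>\<theta>\<bar> \<le> ((B + L) * \<bar>\<theta>\<bar>) * \<bar>\<theta>\<bar>" by (rule mult_right_mono) simp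
    then show "\<bar>\<sigma> \<theta> - \<sigma> 0\<bar> \<le> (B + L) * \<theta>\<^sup>2"
      using \<xi>(2) by (simp add: abs_mult power2_eq_square mult.assoc)
  qed
qed

section \<open>Energy estimate and stability\<close>

text \<open>Summation by parts over the cycle.\<close>

lemma inner_gb_field_fst:
  "u \<bullet> fst (gb_field \<gamma> \<eta> \<sigma> x z) =
    - \<gamma> * (\<Sum>j\<in>UNIV. deriv \<sigma> (\<Delta> j (fst z)) * \<Delta> j u * norm (bvec x (snd z) j))"
  by (simp add: gb_field_def inner_vec_def sum_3 four_eq_one Delta_simps algebra_simps)

text \<open>The diagonal parts are bounded by \<open>lambda1_poincare\<close> and
  \<open>lambda2_le\<close>; everything else is of third order in \<open>norm (u, v)\<close>. The
  shift \<open>vec c\<close> is arbitrary and drops out of all differences, so \<open>K\<close> and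
  \<delta> do not depend on the mean.\<close>

lemma gb_field_energy_estimate:
  assumes "\<gamma> > 0" "\<eta> > 0" "\<sigma> 0 > 0"
    and sign: "\<And>\<theta>. deriv \<sigma> \<theta> * \<theta> \<ge> 0"
    and pos2: "0 < \<kappa>"
    and M: "M > 0"
      "\<And>\<theta>. \<bar>\<theta>\<bar> \<le> 1 \<Longrightarrow> deriv \<sigma> \<theta> * \<theta> \<ge> \<kappa> * \<theta>\<^sup>2 - M * \<bar>\<theta>\<bar>^3"
      "\<And>\<theta>. \<bar>\<theta>\<bar> \<le> 1 \<Longrightarrow> deriv \<sigma> \<theta> * \<theta> \<le> M * \<theta>\<^sup>2"
      "\<And>\<theta>. \<bar>\<theta>\<bar> \<le> 1 \<Longrightarrow> \<bar>\<sigma> \<theta> - \<sigma> 0\<bar> \<le> M * \<theta>\<^sup>2"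
    and eq: "equilibrium_point x a\<^sub>0"
  obtains K \<delta> where "K \<ge> 0" "\<delta> > 0"
    "\<And>j a. norm (a - a\<^sub>0) \<le> \<delta> \<Longrightarrow> norm (bvec x a\<^sub>0 j) / 2 \<le> norm (bvec x a j)"
    "\<And>u v c. u $ 1 + u $ 2 + u $ 3 = 0 \<Longrightarrow> norm (u, v) \<le> \<delta> \<Longrightarrow>
      (u, v) \<bullet> gb_field \<gamma> \<eta> \<sigma> x (vec c + u, a\<^sub>0 + v)
        \<le> - min (\<gamma> * \<kappa> * lambda1 x a\<^sub>0) (\<eta> * \<sigma> 0 * lambda2 x a\<^sub>0) * (norm (u, v))\<^sup>2 + K * norm (u, v)^3"
proof -
  define \<beta> where "\<beta> j = norm (bvec x a\<^sub>0 j)" for j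
  have \<beta>: "0 < \<beta> j" for j
    using eq by (auto simp: \<beta>_def bvec_def equilibrium_point_def)
  \<comment> \<open>The bound 1/2 keeps all differences within the range of the Taylor estimates;
    \<open>\<beta> j / 2\<close> keeps the junction off the vertices and meets the hypothesis of
    \<open>inner_normalized_taylor\<close>.\<close>
  define \<delta> where "\<delta> = Min (insert (1/2) (range (\<lambda>j. \<beta> j / 2)))"
  have \<delta>: "0 < \<delta>" "\<delta> \<le> 1/2" "\<delta> \<le> \<beta> j / 2" for j
  proof -
    show "0 < \<delta>" unfolding \<delta>_def using \<beta> by (subst Min_gr_iff) auto
    show "\<delta> \<le> 1/2" "\<delta> \<le> \<beta> j / 2" unfolding \<delta>_def by (intro Min_le; simp)+
  qed
  \<comment> \<open>\<open>8 * M * \<beta> j\<close> comes from the cubic Taylor error of the first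
    derivative and \<open>8 / (\<beta> j)\<^sup>2\<close> from that of the unit vectors; each
    \<open>4 * M\<close> is a cross term between \<open>u\<close> and \<open>v\<close>.\<close>
  define K1 where "K1 = (\<Sum>j\<in>UNIV. 8 * M * \<beta> j + 4 * M)"
  define K2 where "K2 = (\<Sum>j\<in>UNIV. \<sigma> 0 * (8 / (\<beta> j)\<^sup>2) + 4 * M)"
  have K: "0 \<le> K1" "0 \<le> K2"
    using \<beta> M(1) assms(3) by (auto simp: K1_def K2_def less_imp_le intro!: sum_nonneg add_nonneg_nonneg mult_nonneg_nonneg)
  have bvec_shift: "bvec x (a\<^sub>0 + v) j = bvec x a\<^sub>0 j - v" for v j
    by (simp add: bvec_def)
  have far: "\<beta> j - norm v \<le> norm (bvec x (a\<^sub>0 + v) j)" for v j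
    unfolding bvec_shift \<beta>_def by (rule norm_triangle_ineq2)
  show thesis
  proof (rule that[of "\<gamma> * K1 + \<eta> * K2" \<delta>])
    show "0 \<le> \<gamma> * K1 + \<eta> * K2" using K assms(1,2) by simp
    show "0 < \<delta>" by (rule \<delta>)
    show "norm (bvec x a\<^sub>0 j) / 2 \<le> norm (bvec x a j)" if "norm (a - a\<^sub>0) \<le> \<delta>" for j a
      using far[of j "a - a\<^sub>0"] that \<delta>(3)[of j] by (simp add: \<beta>_def)
    fix u :: "real^3" and v :: "real^2" and c :: real
    assume mean: "u $ 1 + u $ 2 + u $ 3 = 0" and small: "norm (u, v) \<le> \<delta>"
    define s where "s = norm (u, v)"
    define F where "F = gb_field \<gamma> \<eta> \<sigma> x (vec c + u, a\<^sub>0 + v)"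
    have s: "0 \<le> s" "norm u \<le> s" "norm v \<le> s" "s \<le> \<delta>"
      using norm_fst_le[of u v] norm_snd_le[of v u] small by (auto simp: s_def)
    have s2: "s\<^sup>2 = (norm u)\<^sup>2 + (norm v)\<^sup>2" by (simp add: s_def norm_prod_def)
    have \<Delta>_shift: "\<Delta> j (vec c + u) = \<Delta> j u" for j by (simp add: \<Delta>_def)
    have \<Delta>_le: "\<bar>\<Delta> j u\<bar> \<le> 2 * s" for j
      unfolding \<Delta>_def
      using component_le_norm_cart[of u j] component_le_norm_cart[of u "j - 1"] s(2) by linarith
    have \<Delta>_1: "\<bar>\<Delta> j u\<bar> \<le> 1" for j using \<Delta>_le[of j] s(4) \<delta>(2) by linarith
    have \<Delta>2: "(\<Delta> j u)\<^sup>2 \<le> 4 * s\<^sup>2" for j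
      using power_mono[OF \<Delta>_le[of j], of 2] by (simp add: power_mult_distrib)
    have \<Delta>3: "\<bar>\<Delta> j u\<bar>^3 \<le> 8 * s^3" for j
      using power_mono[OF \<Delta>_le[of j], of 3] by (simp add: power_mult_distrib)
    have "\<kappa> * (\<beta> j * (\<Delta> j u)\<^sup>2) - (8 * M * \<beta> j + 4 * M) * s^3
        \<le> deriv \<sigma> (\<Delta> j u) * \<Delta> j u * norm (bvec x (a\<^sub>0 + v) j)" for j
    proof -
      define g where "g = deriv \<sigma> (\<Delta> j u) * \<Delta> j u"
      have "g \<ge> \<kappa> * (\<Delta> j u)\<^sup>2 - M * (8 * s^3)"
        using M(2)[OF \<Delta>_1[of j]] mult_left_mono[OF \<Delta>3[of j] less_imp_le[OF M(1)]] unfolding g_def by linarith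
      then have "(\<kappa> * (\<Delta> j u)\<^sup>2 - M * (8 * s^3)) * \<beta> j \<le> g * \<beta> j"
        using \<beta>[of j] by (intro mult_right_mono) auto
      moreover have "g * s \<le> M * (4 * s\<^sup>2) * s"
        using M(3)[OF \<Delta>_1[of j]] mult_left_mono[OF \<Delta>2[of j] less_imp_le[OF M(1)]] s(1)
        unfolding g_def by (intro mult_right_mono) linarith+
      \<comment> \<open>Replacing the length by a lower bound is legitimate because \<open>g\<close>
        is nonnegative.\<close>
      moreover have "g * (\<beta> j - s) \<le> g * norm (bvec x (a\<^sub>0 + v) j)"
        using far[of j v] s(3) sign[of "\<Delta> j u"] by (intro mult_left_mono) (auto simp: g_def)
      ultimately show ?thesis
        unfolding g_def[symmetric] by (simp add: power2_eq_square power3_eq_cube algebra_simps)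
    qed
    then have "(\<Sum>j\<in>UNIV. \<kappa> * (\<beta> j * (\<Delta> j u)\<^sup>2) - (8 * M * \<beta> j + 4 * M) * s^3)
        \<le> (\<Sum>j\<in>UNIV. deriv \<sigma> (\<Delta> j u) * \<Delta> j u * norm (bvec x (a\<^sub>0 + v) j))"
      by (intro sum_mono)
    then have "\<kappa> * (\<Sum>j\<in>UNIV. \<beta> j * (\<Delta> j u)\<^sup>2) - K1 * s^3
        \<le> (\<Sum>j\<in>UNIV. deriv \<sigma> (\<Delta> j u) * \<Delta> j u * norm (bvec x (a\<^sub>0 + v) j))"
      by (simp add: K1_def sum_subtractf sum_distrib_left sum_distrib_right)
    moreover have "\<kappa> * (lambda1 x a\<^sub>0 * (norm u)\<^sup>2) \<le> \<kappa> * (\<Sum>j\<in>UNIV. \<beta> j * (\<Delta> j u)\<^sup>2)"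
      using lambda1_poincare[OF mean, of x a\<^sub>0] pos2 by (simp add: \<beta>_def)
    ultimately have "\<gamma> * (\<kappa> * (lambda1 x a\<^sub>0 * (norm u)\<^sup>2) - K1 * s^3)
        \<le> \<gamma> * (\<Sum>j\<in>UNIV. deriv \<sigma> (\<Delta> j u) * \<Delta> j u * norm (bvec x (a\<^sub>0 + v) j))"
      using assms(1) by (intro mult_left_mono) auto
    then have fst: "u \<bullet> fst F \<le> - (\<gamma> * \<kappa> * lambda1 x a\<^sub>0) * (norm u)\<^sup>2 + \<gamma> * K1 * s^3"
    proof -
      have "u \<bullet> fst F = - \<gamma> * (\<Sum>j\<in>UNIV. deriv \<sigma> (\<Delta> j u) * \<Delta> j u * norm (bvec x (a\<^sub>0 + v) j))"
        by (simp add: F_def inner_gb_field_fst \<Delta>_shift)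
      with \<open>\<gamma> * (_ - _) \<le> _\<close> show ?thesis by (simp add: right_diff_distrib mult.assoc)
    qed
    define q where "q j = ((norm v)\<^sup>2 - (v \<bullet> bvec x a\<^sub>0 j)\<^sup>2 / (\<beta> j)\<^sup>2) / \<beta> j" for j
    have "\<sigma> (\<Delta> j u) * (v \<bullet> (bvec x (a\<^sub>0 + v) j /\<^sub>R norm (bvec x (a\<^sub>0 + v) j)))
        \<le> \<sigma> 0 * (v \<bullet> (bvec x a\<^sub>0 j /\<^sub>R \<beta> j)) - \<sigma> 0 * q j + (\<sigma> 0 * (8 / (\<beta> j)\<^sup>2) + 4 * M) * s^3" for j
    proof -
      define e where "e = v \<bullet> (bvec x (a\<^sub>0 + v) j /\<^sub>R norm (bvec x (a\<^sub>0 + v) j))"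
      have "bvec x a\<^sub>0 j \<noteq> 0" "norm v \<le> norm (bvec x a\<^sub>0 j) / 2"
        using \<beta>[of j] s(3,4) \<delta>(3)[of j] by (auto simp: \<beta>_def)
      from inner_normalized_taylor[OF this]
      have "e \<le> v \<bullet> (bvec x a\<^sub>0 j /\<^sub>R \<beta> j) - q j + 8 / (\<beta> j)\<^sup>2 * (norm v)^3"
        by (simp add: e_def q_def \<beta>_def bvec_shift divide_inverse mult.commute)
      also have "\<dots> \<le> v \<bullet> (bvec x a\<^sub>0 j /\<^sub>R \<beta> j) - q j + 8 / (\<beta> j)\<^sup>2 * s^3"
        using s(3) by (intro add_left_mono mult_left_mono power_mono) auto
      finally have "\<sigma> 0 * e \<le> \<sigma> 0 * (v \<bullet> (bvec x a\<^sub>0 j /\<^sub>R \<beta> j) - q j + 8 / (\<beta> j)\<^sup>2 * s^3)"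
        using assms(3) by (intro mult_left_mono) auto
      moreover have "(\<sigma> (\<Delta> j u) - \<sigma> 0) * e \<le> (M * (4 * s\<^sup>2)) * s"
      proof -
        have "\<bar>e\<bar> \<le> norm v * norm (bvec x (a\<^sub>0 + v) j /\<^sub>R norm (bvec x (a\<^sub>0 + v) j))"
          unfolding e_def by (rule Cauchy_Schwarz_ineq2)
        also have "\<dots> \<le> s * 1"
        proof (intro mult_mono)
          show "norm (b /\<^sub>R norm b) \<le> 1" for b :: "real^2" by (cases "b = 0") auto
        qed (use s(1,3) in auto)
        finally have "\<bar>e\<bar> \<le> s" by simp
        moreover have "\<bar>\<sigma> (\<Delta> j u) - \<sigma> 0\<bar> \<le> M * (4 * s\<^sup>2)"
          using M(4)[OF \<Delta>_1[of j]] mult_left_mono[OF \<Delta>2[of j] less_imp_le[OF M(1)]] by linarith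
        ultimately have "\<bar>\<sigma> (\<Delta> j u) - \<sigma> 0\<bar> * \<bar>e\<bar> \<le> (M * (4 * s\<^sup>2)) * s"
          using M(1) by (intro mult_mono) auto
        then show ?thesis by (metis abs_ge_self abs_mult order_trans)
      qed
      ultimately show ?thesis
        unfolding e_def[symmetric] by (simp add: power2_eq_square power3_eq_cube algebra_simps)
    qed
    then have "(\<Sum>j\<in>UNIV. \<sigma> (\<Delta> j u) * (v \<bullet> (bvec x (a\<^sub>0 + v) j /\<^sub>R norm (bvec x (a\<^sub>0 + v) j))))
        \<le> (\<Sum>j\<in>UNIV. \<sigma> 0 * (v \<bullet> (bvec x a\<^sub>0 j /\<^sub>R \<beta> j)) - \<sigma> 0 * q j + (\<sigma> 0 * (8 / (\<beta> j)\<^sup>2) + 4 * M) * s^3)"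
      by (intro sum_mono)
    also have "\<dots> = \<sigma> 0 * (v \<bullet> (\<Sum>j\<in>UNIV. bvec x a\<^sub>0 j /\<^sub>R \<beta> j)) - \<sigma> 0 * (\<Sum>j\<in>UNIV. q j) + K2 * s^3"
    proof -
      have "K2 * s^3 = (\<Sum>j\<in>UNIV. (\<sigma> 0 * (8 / (\<beta> j)\<^sup>2) + 4 * M) * s^3)"
        unfolding K2_def by (rule sum_distrib_right)
      then show ?thesis
        by (simp only: sum.distrib[of _ "\<lambda>j. (\<sigma> 0 * (8 / (\<beta> j)\<^sup>2) + 4 * M) * s^3"]
            sum_subtractf inner_sum_right sum_distrib_left)
    qed
    \<comment> \<open>The first-order term vanishes by the equilibrium condition.\<close>
    also have "\<dots> = - \<sigma> 0 * (v \<bullet> (L_mat x a\<^sub>0 *v v)) + K2 * s^3"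
      using eq by (simp add: L_mat_quadratic_form q_def \<beta>_def equilibrium_point_def)
    also have "\<dots> \<le> - \<sigma> 0 * (lambda2 x a\<^sub>0 * (norm v)\<^sup>2) + K2 * s^3"
      using lambda2_le[of x a\<^sub>0 v] assms(3) by simp
    finally have "\<eta> * (\<Sum>j\<in>UNIV. \<sigma> (\<Delta> j u) * (v \<bullet> (bvec x (a\<^sub>0 + v) j /\<^sub>R norm (bvec x (a\<^sub>0 + v) j))))
        \<le> \<eta> * (- \<sigma> 0 * (lambda2 x a\<^sub>0 * (norm v)\<^sup>2) + K2 * s^3)"
      using assms(2) by (intro mult_left_mono) auto
    then have snd: "v \<bullet> snd F \<le> - (\<eta> * \<sigma> 0 * lambda2 x a\<^sub>0) * (norm v)\<^sup>2 + \<eta> * K2 * s^3"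
    proof -
      have "v \<bullet> snd F = \<eta> * (\<Sum>j\<in>UNIV. \<sigma> (\<Delta> j u) *
          (v \<bullet> (bvec x (a\<^sub>0 + v) j /\<^sub>R norm (bvec x (a\<^sub>0 + v) j))))"
        by (simp add: F_def gb_field_def inner_sum_right \<Delta>_shift mult.assoc)
      with \<open>\<eta> * _ \<le> _\<close> show ?thesis
        by (simp add: distrib_left right_diff_distrib mult.assoc)
    qed
    define \<mu> where "\<mu> = min (\<gamma> * \<kappa> * lambda1 x a\<^sub>0) (\<eta> * \<sigma> 0 * lambda2 x a\<^sub>0)"
    have "\<mu> * (norm u)\<^sup>2 \<le> (\<gamma> * \<kappa> * lambda1 x a\<^sub>0) * (norm u)\<^sup>2"
         "\<mu> * (norm v)\<^sup>2 \<le> (\<eta> * \<sigma> 0 * lambda2 x a\<^sub>0) * (norm v)\<^sup>2"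
      by (intro mult_right_mono; simp add: \<mu>_def)+
    moreover have "(u, v) \<bullet> F = u \<bullet> fst F + v \<bullet> snd F" by (simp add: inner_prod_def)
    ultimately have "(u, v) \<bullet> F \<le> - \<mu> * s\<^sup>2 + (\<gamma> * K1 + \<eta> * K2) * s^3"
      using fst snd unfolding s2 by (simp add: algebra_simps)
    then show "(u, v) \<bullet> gb_field \<gamma> \<eta> \<sigma> x (vec c + u, a\<^sub>0 + v)
        \<le> - min (\<gamma> * \<kappa> * lambda1 x a\<^sub>0) (\<eta> * \<sigma> 0 * lambda2 x a\<^sub>0) * (norm (u, v))\<^sup>2
          + (\<gamma> * K1 + \<eta> * K2) * norm (u, v)^3"
      by (simp add: F_def \<mu>_def s_def)
  qed
qed

section \<open>Solutions as integral curves, their uniqueness and stability\<close>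

lemma grain_boundary_solutionI:
  assumes "\<And>t. t \<in> J \<Longrightarrow> (z has_vector_derivative gb_field \<gamma> \<eta> \<sigma> x (z t)) (at t within J)"
    and "continuous_on J (\<lambda>t. gb_field \<gamma> \<eta> \<sigma> x (z t))"
    and "\<And>t j. t \<in> J \<Longrightarrow> snd (z t) \<noteq> x $ j"
  shows "grain_boundary_solution \<gamma> \<eta> \<sigma> x J (\<lambda>t. fst (z t)) (\<lambda>t. snd (z t))"
  unfolding grain_boundary_solution_def
proof (intro conjI ballI allI exI)
  let ?G = "\<lambda>t. gb_field \<gamma> \<eta> \<sigma> x (z t)"
  show "continuous_on J (\<lambda>t. fst (?G t))" "continuous_on J (\<lambda>t. snd (?G t))"
    by (intro continuous_on_fst continuous_on_snd assms(2))+
  fix t assume t: "t \<in> J"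
  show "((\<lambda>t. fst (z t)) has_vector_derivative fst (?G t)) (at t within J)"
    by (rule bounded_linear.has_vector_derivative[OF bounded_linear_fst assms(1)[OF t]])
  show "((\<lambda>t. snd (z t)) has_vector_derivative snd (?G t)) (at t within J)"
    by (rule bounded_linear.has_vector_derivative[OF bounded_linear_snd assms(1)[OF t]])
qed (use assms(3) in \<open>simp_all add: gb_field_def\<close>)

lemma grain_boundary_solutionD:
  assumes "grain_boundary_solution \<gamma> \<eta> \<sigma> x J \<alpha> a" "t \<in> J"
  shows "((\<lambda>t. (\<alpha> t, a t)) has_vector_derivative gb_field \<gamma> \<eta> \<sigma> x (\<alpha> t, a t)) (at t within J)"
    and "a t \<noteq> x $ j"
proof -
  obtain \<alpha>' a' where "(\<alpha> has_vector_derivative \<alpha>' t) (at t within J)"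
      "(a has_vector_derivative a' t) (at t within J)"
    and "\<forall>j. \<alpha>' t $ j = - \<gamma> * (deriv \<sigma> (\<Delta> (j + 1) (\<alpha> t)) * norm (bvec x (a t) (j + 1))
                 - deriv \<sigma> (\<Delta> j (\<alpha> t)) * norm (bvec x (a t) j))"
      "a' t = \<eta> *\<^sub>R (\<Sum>j\<in>UNIV. \<sigma> (\<Delta> j (\<alpha> t)) *\<^sub>R (bvec x (a t) j /\<^sub>R norm (bvec x (a t) j)))"
    using assms unfolding grain_boundary_solution_def by blast
  moreover from this have "gb_field \<gamma> \<eta> \<sigma> x (\<alpha> t, a t) = (\<alpha>' t, a' t)"
    by (simp add: gb_field_def vec_eq_iff)
  ultimately show "((\<lambda>t. (\<alpha> t, a t)) has_vector_derivative gb_field \<gamma> \<eta> \<sigma> x (\<alpha> t, a t)) (at t within J)"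
    by (simp add: has_vector_derivative_Pair)
  show "a t \<noteq> x $ j" using assms by (simp add: grain_boundary_solution_def)
qed

text \<open>No smallness is assumed. Over \<open>{0..T}\<close> both trajectories sweep out compact
  sets that avoid the vertices, hence keep a positive distance from them, and the field is Lipschitz
  on the union.\<close>

lemma grain_boundary_solution_unique:
  assumes \<sigma>: "\<And>\<theta>. (\<sigma> has_real_derivative deriv \<sigma> \<theta>) (at \<theta>)"
    "\<And>\<theta>. (deriv \<sigma> has_real_derivative \<sigma>2 \<theta>) (at \<theta>)" "continuous_on UNIV \<sigma>2"
    and y: "grain_boundary_solution \<gamma> \<eta> \<sigma> x J \<alpha> a" "{0..T} \<subseteq> J"
    and z: "grain_boundary_solution \<gamma> \<eta> \<sigma> x J' \<alpha>' a'" "{0..T} \<subseteq> J'"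
    and "0 \<le> T" "\<alpha> 0 = \<alpha>' 0" "a 0 = a' 0"
  shows "\<alpha> T = \<alpha>' T \<and> a T = a' T"
proof -
  define Y Z where "Y t = (\<alpha> t, a t)" and "Z t = (\<alpha>' t, a' t)" for t
  have Y: "(Y has_vector_derivative gb_field \<gamma> \<eta> \<sigma> x (Y t)) (at t within {0..T})"
    and Z: "(Z has_vector_derivative gb_field \<gamma> \<eta> \<sigma> x (Z t)) (at t within {0..T})"
    if "t \<in> {0..T}" for t
  proof -
    have t: "t \<in> J" "t \<in> J'" using that y(2) z(2) by auto
    show "(Y has_vector_derivative gb_field \<gamma> \<eta> \<sigma> x (Y t)) (at t within {0..T})"
      unfolding Y_def
      by (rule has_vector_derivative_within_subset[OF grain_boundary_solutionD(1)[OF y(1) t(1)] y(2)])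
    show "(Z has_vector_derivative gb_field \<gamma> \<eta> \<sigma> x (Z t)) (at t within {0..T})"
      unfolding Z_def
      by (rule has_vector_derivative_within_subset[OF grain_boundary_solutionD(1)[OF z(1) t(2)] z(2)])
  qed
  define S where "S = Y ` {0..T} \<union> Z ` {0..T}"
  have "continuous_on {0..T} Y" "continuous_on {0..T} Z"
    unfolding continuous_on_eq_continuous_within
    using Y Z has_vector_derivative_continuous by blast+
  then have S: "compact S" unfolding S_def by (intro compact_Un compact_continuous_image) auto
  have away: "snd p \<noteq> x $ j" if "p \<in> S" for p j
    using that grain_boundary_solutionD(2)[OF y(1)] grain_boundary_solutionD(2)[OF z(1)] y(2) z(2)
    by (auto simp: S_def Y_def Z_def)
  have "\<exists>r>0. \<forall>p\<in>S. r \<le> norm (bvec x (snd p) j)" for j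
  proof -
    have "S \<noteq> {}" using \<open>0 \<le> T\<close> by (auto simp: S_def)
    moreover have "continuous_on S (\<lambda>p. norm (bvec x (snd p) j))"
      unfolding bvec_def by (intro continuous_intros)
    ultimately obtain p where "p \<in> S" "\<forall>q\<in>S. norm (bvec x (snd p) j) \<le> norm (bvec x (snd q) j)"
      using continuous_attains_inf[OF S] by blast
    then show ?thesis using away[of p j] by (intro exI[of _ "norm (bvec x (snd p) j)"]) (auto simp: bvec_def)
  qed
  then obtain r where r: "\<And>j. 0 < r j" "\<And>j p. p \<in> S \<Longrightarrow> r j \<le> norm (bvec x (snd p) j)" by metis
  have "0 < Min (range r)" using r(1) by (subst Min_gr_iff) auto
  moreover have "Min (range r) \<le> norm (bvec x (snd p) j)" if "p \<in> S" for p j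
    by (rule order_trans[OF Min_le r(2)[OF that]]) auto
  ultimately obtain L where L: "\<And>p q. p \<in> S \<Longrightarrow> q \<in> S \<Longrightarrow>
      norm (gb_field \<gamma> \<eta> \<sigma> x p - gb_field \<gamma> \<eta> \<sigma> x q) \<le> L * norm (p - q)"
    by (rule gb_field_lipschitz[OF \<sigma> compact_imp_bounded[OF S]]) blast+
  have "Y T = Z T"
  proof (rule ode_unique[OF \<open>0 \<le> T\<close> Y Z])
    show "norm (gb_field \<gamma> \<eta> \<sigma> x (Y t) - gb_field \<gamma> \<eta> \<sigma> x (Z t)) \<le> L * norm (Y t - Z t)"
      if "t \<in> {0..T}" for t
      using that by (intro L) (auto simp: S_def)
    show "Y 0 = Z 0" using assms by (simp add: Y_def Z_def)
  qed
  then show ?thesis by (simp add: Y_def Z_def)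
qed

text \<open>The clause over \<open>J\<close> gives sense to "the associated solution": any solution
  with the same data is a restriction of the global one. The exponent provided is the minimum of the
  two gaps itself.\<close>

theorem theorem5p9:
  fixes \<gamma> \<eta> :: real and \<sigma> :: "real \<Rightarrow> real"
    and x :: "real^2^3" and a_inf :: "real^2"
  assumes "\<gamma> > 0" and "\<eta> > 0"
    and "C_diff 3 \<sigma>"
    and "\<sigma> 0 > 0" and "\<And>\<theta>. \<sigma> \<theta> \<ge> \<sigma> 0"
    and "\<And>\<theta>. deriv \<sigma> \<theta> * \<theta> \<ge> 0"
    and "deriv (deriv \<sigma>) 0 > 0"
    and "\<And>\<theta>. deriv \<sigma> \<theta> = 0 \<longleftrightarrow> \<theta> = 0"
    and "vertex_condition x"
    and "equilibrium_point x a_inf"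
  shows "\<exists>\<epsilon>>0. \<forall>(\<alpha>0 :: real^3) (a0 :: real^2).
    norm (\<alpha>0 - mean_vec \<alpha>0) + norm (a0 - a_inf) < \<epsilon> \<longrightarrow>
    (\<exists>\<alpha> a.
      grain_boundary_solution \<gamma> \<eta> \<sigma> x {0..} \<alpha> a \<and> \<alpha> 0 = \<alpha>0 \<and> a 0 = a0 \<and>
      (\<forall>J \<alpha>' a'. is_interval J \<and> 0 \<in> J \<and> J \<subseteq> {0..} \<and>
         grain_boundary_solution \<gamma> \<eta> \<sigma> x J \<alpha>' a' \<and> \<alpha>' 0 = \<alpha>0 \<and> a' 0 = a0 \<longrightarrow>
         (\<forall>t\<in>J. \<alpha>' t = \<alpha> t \<and> a' t = a t)) \<and>
      (\<exists>C>0. \<exists>\<mu>>0.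
         \<mu> \<ge> min (\<gamma> * deriv (deriv \<sigma>) 0 * lambda1 x a_inf) (\<eta> * \<sigma> 0 * lambda2 x a_inf) \<and>
         (\<forall>t\<ge>0. norm (\<alpha> t - mean_vec \<alpha>0) + norm (a t - a_inf) \<le> C * exp (- \<mu> * t))))"
proof -
  define \<mu> where "\<mu> = min (\<gamma> * deriv (deriv \<sigma>) 0 * lambda1 x a_inf) (\<eta> * \<sigma> 0 * lambda2 x a_inf)"
  have ne: "a_inf \<noteq> x $ j" for j using assms(10) by (simp add: equilibrium_point_def)
  have \<mu>: "0 < \<mu>"
    using assms(1,2,4,7) lambda1_pos[of a_inf x, OF ne] lambda2_pos[OF assms(10)] by (simp add: \<mu>_def)
  obtain \<sigma>3 where \<sigma>: "\<And>\<theta>. (\<sigma> has_real_derivative deriv \<sigma> \<theta>) (at \<theta>)"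
    "\<And>\<theta>. (deriv \<sigma> has_real_derivative deriv (deriv \<sigma>) \<theta>) (at \<theta>)"
    "\<And>\<theta>. (deriv (deriv \<sigma>) has_real_derivative \<sigma>3 \<theta>) (at \<theta>)" "continuous_on UNIV \<sigma>3"
    using assms(3) by (rule C_diff_3D) blast
  have \<sigma>2_cont: "continuous_on UNIV (deriv (deriv \<sigma>))"
    using \<sigma>(3) by (intro continuous_at_imp_continuous_on) (auto intro: DERIV_isCont)
  have "deriv \<sigma> 0 = 0" using assms(8) by simp
  from sigma_taylor[OF \<sigma> this] obtain M where M: "M > 0"
    "\<And>\<theta>. \<bar>\<theta>\<bar> \<le> 1 \<Longrightarrow> deriv \<sigma> \<theta> * \<theta> \<ge> deriv (deriv \<sigma>) 0 * \<theta>\<^sup>2 - M * \<bar>\<theta>\<bar>^3"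
    "\<And>\<theta>. \<bar>\<theta>\<bar> \<le> 1 \<Longrightarrow> deriv \<sigma> \<theta> * \<theta> \<le> M * \<theta>\<^sup>2"
    "\<And>\<theta>. \<bar>\<theta>\<bar> \<le> 1 \<Longrightarrow> \<bar>\<sigma> \<theta> - \<sigma> 0\<bar> \<le> M * \<theta>\<^sup>2" by blast
  obtain K \<delta>\<^sub>0 where K: "K \<ge> 0" "\<delta>\<^sub>0 > 0"
    and near: "\<And>j a. norm (a - a_inf) \<le> \<delta>\<^sub>0 \<Longrightarrow> norm (bvec x a_inf j) / 2 \<le> norm (bvec x a j)"
    and energy: "\<And>u v m. u $ 1 + u $ 2 + u $ 3 = 0 \<Longrightarrow> norm (u, v) \<le> \<delta>\<^sub>0 \<Longrightarrow>
      (u, v) \<bullet> gb_field \<gamma> \<eta> \<sigma> x (vec m + u, a_inf + v) \<le> - \<mu> * (norm (u, v))\<^sup>2 + K * norm (u, v)^3"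
    using gb_field_energy_estimate[OF assms(1,2,4,6,7) M assms(10)] unfolding \<mu>_def by blast
  \<comment> \<open>The second bound yields \<open>K * \<delta> \<le> \<mu> / 2\<close>;
    \<open>K + 1\<close> guards against \<open>K = 0\<close>. This \<delta> is also the final
    \<epsilon>.\<close>
  define \<delta> where "\<delta> = min \<delta>\<^sub>0 (\<mu> / (2 * (K + 1)))"
  have \<delta>: "0 < \<delta>" "\<delta> \<le> \<delta>\<^sub>0" using K \<mu> by (auto simp: \<delta>_def)
  have "K * \<delta> \<le> (K + 1) * (\<mu> / (2 * (K + 1)))"
    using K(1) \<delta>(1) by (intro mult_mono) (auto simp: \<delta>_def)
  also have "\<dots> = \<mu> / 2" using K(1) by (simp add: field_simps)
  finally have K\<delta>: "K * \<delta> \<le> \<mu> / 2" .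
  define r where "r = Min (range (\<lambda>j. norm (bvec x a_inf j) / 2))"
  have r: "0 < r" unfolding r_def using ne[symmetric] by (subst Min_gr_iff) (auto simp: bvec_def)
  have r_le: "r \<le> norm (bvec x a j)" if "norm (a - a_inf) \<le> \<delta>" for a j
  proof -
    have "r \<le> norm (bvec x a_inf j) / 2" unfolding r_def by (rule Min_le) auto
    also have "\<dots> \<le> norm (bvec x a j)" using near that \<delta>(2) by simp
    finally show ?thesis .
  qed
  define F where "F = gb_field \<gamma> \<eta> \<sigma> x"
  have main: "\<exists>z. grain_boundary_solution \<gamma> \<eta> \<sigma> x {0..} (\<lambda>t. fst (z t)) (\<lambda>t. snd (z t)) \<and> z 0 = (\<alpha>0, a0) \<and>
      (\<forall>t\<ge>0. norm (z t - (mean_vec \<alpha>0, a_inf)) \<le> \<delta> * exp (1 - \<mu> * t))"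
    if init: "norm (\<alpha>0 - mean_vec \<alpha>0) + norm (a0 - a_inf) < \<delta>" for \<alpha>0 a0
  proof -
    define m where "m = (\<alpha>0 $ 1 + \<alpha>0 $ 2 + \<alpha>0 $ 3) / 3"
    have mean: "mean_vec \<alpha>0 = vec m" by (simp add: mean_vec_def m_def vec_eq_iff)
    \<comment> \<open>\<open>c\<close> is the limit point selected by the data, and orthogonality to
      \<open>w\<close> says that the components of \<alpha> have the same sum as at
      \<open>c\<close>.\<close>
    define c w :: "(real^3) \<times> (real^2)" where "c = (vec m, a_inf)" and "w = (vec 1, 0)"
    have w: "w \<bullet> p = fst p $ 1 + fst p $ 2 + fst p $ 3" for p
      by (simp add: w_def inner_prod_def inner_vec_def sum_3)
    have snd_c: "norm (snd p - a_inf) \<le> norm (p - c)" for p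
      by (cases p) (simp add: c_def norm_snd_le)
    have away: "r \<le> norm (bvec x (snd p) j)" if "p \<in> cball c \<delta>" for p j
      using that snd_c[of p] by (intro r_le) (simp add: dist_norm norm_minus_commute)
    obtain L where L: "L > 0" "\<And>p q. p \<in> cball c \<delta> \<Longrightarrow> q \<in> cball c \<delta> \<Longrightarrow> norm (F p - F q) \<le> L * norm (p - q)"
      using gb_field_lipschitz[OF \<sigma>(1,2) \<sigma>2_cont bounded_cball r away, of c \<delta> \<gamma> \<eta>]
      unfolding F_def by blast
    have en: "(p - c) \<bullet> F p \<le> - \<mu> * (norm (p - c))\<^sup>2 + K * norm (p - c)^3"
      if "p \<in> cball c \<delta>" "w \<bullet> (p - c) = 0" for p
    proof -
      have p: "p - c = (fst p - vec m, snd p - a_inf)" by (simp add: c_def prod_eq_iff)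
      have "norm (p - c) \<le> \<delta>\<^sub>0" using that(1) \<delta>(2) by (simp add: dist_norm norm_minus_commute)
      with energy[of "fst p - vec m" "snd p - a_inf" m] that(2) show ?thesis
        by (simp add: p F_def w)
    qed
    have inward: "(p - c) \<bullet> F p \<le> 0" if "p \<in> cball c \<delta>" "w \<bullet> (p - c) = 0" for p
    proof -
      have "K * norm (p - c)^3 = (K * norm (p - c)) * (norm (p - c))\<^sup>2"
        by (simp add: power3_eq_cube power2_eq_square)
      also have "\<dots> \<le> \<mu> * (norm (p - c))\<^sup>2"
      proof (rule mult_right_mono)
        have "K * norm (p - c) \<le> K * \<delta>"
          using that(1) K(1) by (intro mult_left_mono) (simp_all add: dist_norm norm_minus_commute)
        then show "K * norm (p - c) \<le> \<mu>" using K\<delta> \<mu> by linarith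
      qed simp
      finally show ?thesis using en[OF that] by linarith
    qed
    \<comment> \<open>A constant vector has no differences, so summation by parts annihilates the
      flux.\<close>
    have cons: "w \<bullet> F p = 0" for p
    proof -
      have "w \<bullet> F p = (vec 1 :: real^3) \<bullet> fst (F p)" by (simp add: w_def inner_prod_def)
      then show ?thesis by (simp add: F_def inner_gb_field_fst \<Delta>_def)
    qed
    have "norm ((\<alpha>0, a0) - c) < \<delta>"
      using init norm_Pair_le[of "\<alpha>0 - vec m" "a0 - a_inf"] by (simp add: c_def mean)
    then have z0: "(\<alpha>0, a0) \<in> cball c \<delta>" by (simp add: dist_norm norm_minus_commute)
    have w0: "w \<bullet> ((\<alpha>0, a0) - c) = 0" by (simp add: w c_def m_def field_simps)
    obtain z where z: "z 0 = (\<alpha>0, a0)"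
      "\<And>t. 0 \<le> t \<Longrightarrow> (z has_vector_derivative F (z t)) (at t within {0..})"
      "\<And>t. 0 \<le> t \<Longrightarrow> z t \<in> cball c \<delta>" "\<And>t. 0 \<le> t \<Longrightarrow> w \<bullet> (z t - c) = 0"
      by (rule ode_exists_in_cball[OF L(1) \<delta>(1) L(2) cons inward z0 w0]) blast+
    have sol: "grain_boundary_solution \<gamma> \<eta> \<sigma> x {0..} (\<lambda>t. fst (z t)) (\<lambda>t. snd (z t))"
    proof (rule grain_boundary_solutionI)
      have "L-lipschitz_on (cball c \<delta>) F"
        using L by (intro lipschitz_onI) (auto simp: dist_norm)
      then have F: "continuous_on (cball c \<delta>) F" by (rule lipschitz_on_continuous_on)
      have "continuous_on {0..} z"
        unfolding continuous_on_eq_continuous_within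
        using has_vector_derivative_continuous[OF z(2)] by simp
      moreover have "z ` {0..} \<subseteq> cball c \<delta>" using z(3) by blast
      ultimately show "continuous_on {0..} (\<lambda>t. gb_field \<gamma> \<eta> \<sigma> x (z t))"
        unfolding F_def[symmetric] by (rule continuous_on_compose2[OF F])
      show "snd (z t) \<noteq> x $ j" if "t \<in> {0..}" for t j
        using away[OF z(3), of t j] r that by (auto simp: bvec_def)
    qed (use z(2) in \<open>simp add: F_def\<close>)
    have "norm (z t - c) \<le> \<delta> * exp (1 - \<mu> * t)" if "0 \<le> t" for t
    proof (rule exponential_decay[OF \<mu> \<delta>(1) K(1) K\<delta> z(2) _ en[OF z(3,4)] that])
      show "norm (z t - c) \<le> \<delta>" if "0 \<le> t" for t
        using z(3)[OF that] by (simp add: dist_norm norm_minus_commute)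
    qed
    then show ?thesis using sol z(1) by (auto simp: c_def mean)
  qed
  show ?thesis
  proof (intro exI[of _ \<delta>] conjI allI impI \<delta>(1))
    fix \<alpha>0 :: "real^3" and a0 :: "real^2"
    assume "norm (\<alpha>0 - mean_vec \<alpha>0) + norm (a0 - a_inf) < \<delta>"
    from main[OF this] obtain z
      where sol: "grain_boundary_solution \<gamma> \<eta> \<sigma> x {0..} (\<lambda>t. fst (z t)) (\<lambda>t. snd (z t))"
        and z0: "z 0 = (\<alpha>0, a0)"
        and decay: "\<And>t. 0 \<le> t \<Longrightarrow> norm (z t - (mean_vec \<alpha>0, a_inf)) \<le> \<delta> * exp (1 - \<mu> * t)"
      by blast
    have unique: "\<alpha>' t = fst (z t) \<and> a' t = snd (z t)"
      if J: "is_interval J" "0 \<in> J" "J \<subseteq> {0..}" "t \<in> J"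
        and sol': "grain_boundary_solution \<gamma> \<eta> \<sigma> x J \<alpha>' a'" "\<alpha>' 0 = \<alpha>0" "a' 0 = a0"
      for J \<alpha>' a' t
    proof (rule grain_boundary_solution_unique[OF \<sigma>(1,2) \<sigma>2_cont sol'(1) _ sol])
      \<comment> \<open>An interval containing 0 and \<open>t\<close> contains everything between,
        so the comparison can run up to each time of \<open>J\<close>.\<close>
      show "{0..t} \<subseteq> J" using J by (meson atLeastAtMost_iff mem_is_interval_1_I subsetI)
      show "0 \<le> t" using J by auto
    qed (use sol' z0 in auto)
    \<comment> \<open>The factor 2 passes from the norm of the pair to the sum of the two norms;
      \<open>\<delta> * exp 1\<close> is the constant of \<open>exponential_decay\<close>.\<close>
    have bound: "norm (fst (z t) - mean_vec \<alpha>0) + norm (snd (z t) - a_inf) \<le> 2 * \<delta> * exp 1 * exp (- \<mu> * t)"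
      if "0 \<le> t" for t
    proof -
      let ?p = "z t - (mean_vec \<alpha>0, a_inf)"
      have "norm (fst ?p) + norm (snd ?p) \<le> 2 * norm ?p"
        using norm_fst_le[of "fst ?p" "snd ?p"] norm_snd_le[of "snd ?p" "fst ?p"]
        by (cases "z t") simp
      also have "\<dots> \<le> 2 * (\<delta> * exp (1 - \<mu> * t))" using decay[OF that] by simp
      also have "\<dots> = 2 * \<delta> * exp 1 * exp (- \<mu> * t)" by (simp add: exp_diff exp_minus divide_inverse)
      finally show ?thesis by simp
    qed
    show "\<exists>\<alpha> a.
      grain_boundary_solution \<gamma> \<eta> \<sigma> x {0..} \<alpha> a \<and> \<alpha> 0 = \<alpha>0 \<and> a 0 = a0 \<and>
      (\<forall>J \<alpha>' a'. is_interval J \<and> 0 \<in> J \<and> J \<subseteq> {0..} \<and>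
         grain_boundary_solution \<gamma> \<eta> \<sigma> x J \<alpha>' a' \<and> \<alpha>' 0 = \<alpha>0 \<and> a' 0 = a0 \<longrightarrow>
         (\<forall>t\<in>J. \<alpha>' t = \<alpha> t \<and> a' t = a t)) \<and>
      (\<exists>C>0. \<exists>\<mu>>0.
         \<mu> \<ge> min (\<gamma> * deriv (deriv \<sigma>) 0 * lambda1 x a_inf) (\<eta> * \<sigma> 0 * lambda2 x a_inf) \<and>
         (\<forall>t\<ge>0. norm (\<alpha> t - mean_vec \<alpha>0) + norm (a t - a_inf) \<le> C * exp (- \<mu> * t)))"
    proof (intro exI[of _ "\<lambda>t. fst (z t)"] exI[of _ "\<lambda>t. snd (z t)"] conjI sol)
      show "\<exists>C>0. \<exists>\<mu>>0.
         \<mu> \<ge> min (\<gamma> * deriv (deriv \<sigma>) 0 * lambda1 x a_inf) (\<eta> * \<sigma> 0 * lambda2 x a_inf) \<and>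
         (\<forall>t\<ge>0. norm (fst (z t) - mean_vec \<alpha>0) + norm (snd (z t) - a_inf) \<le> C * exp (- \<mu> * t))"
      proof (rule exI[of _ "2 * \<delta> * exp 1"], intro conjI)
        show "0 < 2 * \<delta> * exp 1" using \<delta>(1) by simp
        show "\<exists>\<mu>>0.
          \<mu> \<ge> min (\<gamma> * deriv (deriv \<sigma>) 0 * lambda1 x a_inf) (\<eta> * \<sigma> 0 * lambda2 x a_inf) \<and>
          (\<forall>t\<ge>0. norm (fst (z t) - mean_vec \<alpha>0) + norm (snd (z t) - a_inf)
            \<le> 2 * \<delta> * exp 1 * exp (- \<mu> * t))"
          unfolding \<mu>_def[symmetric] using bound \<mu> by blast
      qed
    qed (use z0 unique in auto)
  qed
qed

end
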